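(* Let $K$ and $L$ be countable completely normal distributive $0$-lattices and let $\varphi\colon K\to L$ be a $0$-lattice homomorphism. Then the following are equivalent: (a) there are Abelian lattice-ordered groups $G$ and $H$, an $\ell$-homomorphism $f\colon G\to H$, and lattice isomorphisms $\alpha\colon\operatorname{Id_c}G\to K$ and $\beta\colon\operatorname{Id_c}H\to L$ such that $\varphi\circ\alpha=\beta\circ\operatorname{Id_c}f$; (b) $\varphi$ is closed.
   Context: "Countable" means "at most countable". For an Abelian lattice-ordered group $G$, write $G^+=\{x\in G\mid 0\le x\}$, $|x|=x\vee(-x)$, and for $a\in G$ let $\langle a\rangle_G=\{x\in G\mid (\exists n\in\mathbb{N})\ |x|\le n|a|\}$ be the principal $\ell$-ideal generated by $a$. $\operatorname{Id_c}G=\{\langle a\rangle_G\mid a\in G^+\}$, ordered by inclusion, is a distributive lattice with least element $\{0\}$. An $\ell$-homomorphism is a map that is both a group homomorphism and a lattice homomorphism; for such $f\colon G\to H$, $\operatorname{Id_c}f\colon\operatorname{Id_c}G\to\operatorname{Id_c}H$ is the map $\langle x\rangle_G\mapsto\langle f(x)\rangle_H$. A distributive $0$-lattice is a distributive lattice with a least element $0$; a $0$-lattice homomorphism is a lattice homomorphism preserving $0$. A distributive $0$-lattice $L$ is completely normal if for all $a,b\in L$ there are $x,y\in L$ such that $a\vee b=a\vee y=x\vee b$ and $x\wedge y=0$. A lattice homomorphism $f\colon K\to L$ is closed if for all $a,b\in K$ and all $x\in L$ with $f(a)\le f(b)\vee x$ there exists $u\in K$ such that $a\le b\vee u$ and $f(u)\le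 x$. *)

theory Defs
  imports "HOL-Library.Countable_Set" "HOL-Algebra.Group" "HOL-Algebra.Lattice"
begin

text \<open>
  The lattices \<open>K\<close> and \<open>L\<close> are universally quantified in the theorem and are rendered as types of sort
  \<open>{distrib_lattice, bounded_lattice_bot}\<close> (distributive lattices with a least element).
  The lattice-ordered groups are existentially quantified, so they are rendered as structures with
  an explicit carrier set, on top of the group and lattice locales of HOL-Algebra.
  The names \<open>sup\<close> and \<open>inf\<close> are taken by HOL-Algebra; the type class operations
  are therefore written \<open>sup_class.sup\<close> and \<open>inf_class.inf\<close>.
\<close>

section \<open>Distributive lattices with zero\<close>

definition completely_normal :: "'a::{distrib_lattice, bounded_lattice_bot} itself \<Rightarrow> bool" where
  "completely_normal _ \<longleftrightarrow>
     (\<forall>a b :: 'a. \<exists>x y.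
        sup_class.sup a b = sup_class.sup a y \<and>
        sup_class.sup a b = sup_class.sup x b \<and>
        inf_class.inf x y = bot)"

definition zero_lattice_hom ::
  "('k::{distrib_lattice, bounded_lattice_bot} \<Rightarrow> 'l::{distrib_lattice, bounded_lattice_bot}) \<Rightarrow> bool"
where
  "zero_lattice_hom \<phi> \<longleftrightarrow>
     (\<forall>x y. \<phi> (sup_class.sup x y) = sup_class.sup (\<phi> x) (\<phi> y)) \<and>
     (\<forall>x y. \<phi> (inf_class.inf x y) = inf_class.inf (\<phi> x) (\<phi> y)) \<and>
     \<phi> bot = bot"

definition closed_hom ::
  "('k::{distrib_lattice, bounded_lattice_bot} \<Rightarrow> 'l::{distrib_lattice, bounded_lattice_bot}) \<Rightarrow> bool"
where
  "closed_hom \<phi> \<longleftrightarrow>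
     (\<forall>a b x. \<phi> a \<le> sup_class.sup (\<phi> b) x \<longrightarrow>
        (\<exists>u. a \<le> sup_class.sup b u \<and> \<phi> u \<le> x))"

definition type_order :: "'a::order gorder" where
  "type_order = \<lparr>carrier = UNIV, eq = (=), le = (\<le>)\<rparr>"

definition lattice_iso :: "'a gorder \<Rightarrow> 'b gorder \<Rightarrow> ('a \<Rightarrow> 'b) \<Rightarrow> bool" where
  "lattice_iso X Y \<alpha> \<longleftrightarrow>
     bij_betw \<alpha> (carrier X) (carrier Y) \<and> join_pres X Y \<alpha> \<and> meet_pres X Y \<alpha>"


section \<open>Abelian lattice-ordered groups\<close>

text \<open>
  HOL-Algebra groups are multiplicative: \<open>\<otimes>\<close>, \<open>\<one>\<close>, \<open>inv x\<close> and
  \<open>x [^] n\<close> stand for the additive \<open>x + y\<close>, \<open>0\<close>, \<open>- x\<close> and \<open>n x\<close>.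
\<close>

record 'a lgroup = "'a monoid" +
  lgle :: "'a \<Rightarrow> 'a \<Rightarrow> bool"

definition lorder :: "('a, 'm) lgroup_scheme \<Rightarrow> 'a gorder" where
  "lorder G = \<lparr>carrier = carrier G, eq = (=), le = lgle G\<rparr>"

locale abelian_lgroup = comm_group G + ord: lattice "lorder G" for G (structure) +
  assumes translation_mono:
    "\<lbrakk>x \<in> carrier G; y \<in> carrier G; z \<in> carrier G; lgle G x y\<rbrakk> \<Longrightarrow> lgle G (z \<otimes> x) (z \<otimes> y)"

definition lhom :: "('g, 'm) lgroup_scheme \<Rightarrow> ('h, 'n) lgroup_scheme \<Rightarrow> ('g \<Rightarrow> 'h) \<Rightarrow> bool" where
  "lhom G H f \<longleftrightarrow>
     f \<in> hom G H \<and> join_pres (lorder G) (lorder H) f \<and> meet_pres (lorder G) (lorder H) f"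

definition pos_cone :: "('a, 'm) lgroup_scheme \<Rightarrow> 'a set" where
  "pos_cone G = {x \<in> carrier G. lgle G \<one>\<^bsub>G\<^esub> x}"

definition labs :: "('a, 'm) lgroup_scheme \<Rightarrow> 'a \<Rightarrow> 'a" where
  "labs G x = x \<squnion>\<^bsub>lorder G\<^esub> inv\<^bsub>G\<^esub> x"

definition principal_lideal :: "('a, 'm) lgroup_scheme \<Rightarrow> 'a \<Rightarrow> 'a set" where
  "principal_lideal G a =
     {x \<in> carrier G. \<exists>n::nat. lgle G (labs G x) (labs G a [^]\<^bsub>G\<^esub> n)}"

definition Idc :: "('a, 'm) lgroup_scheme \<Rightarrow> 'a set gorder" where
  "Idc G = \<lparr>carrier = principal_lideal G ` pos_cone G, eq = (=), le = (\<subseteq>)\<rparr>"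

text \<open>
  For an \<open>\<ell>\<close>-homomorphism \<open>f\<close> the ideal generated by \<open>f x\<close> depends only on the ideal generated by
  \<open>x\<close>, so the definite description below is well defined on the carrier of \<open>Idc G\<close>
  (see \<open>Idc_map_principal\<close>).
\<close>

definition Idc_map ::
  "('g, 'm) lgroup_scheme \<Rightarrow> ('h, 'n) lgroup_scheme \<Rightarrow> ('g \<Rightarrow> 'h) \<Rightarrow> 'g set \<Rightarrow> 'h set" where
  "Idc_map G H f I =
     (THE J. \<exists>x\<in>pos_cone G. I = principal_lideal G x \<and> J = principal_lideal H (f x))"

context abelian_lgroup
begin

lemma labs_closed: "x \<in> carrier G \<Longrightarrow> labs G x \<in> carrier G"
  using ord.join_closed[of x "inv x"] by (simp add: labs_def lorder_def)

lemma lg_refl: "x \<in> carrier G \<Longrightarrow> lgle G x x"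
  using ord.le_refl[of x] by (simp add: lorder_def)

lemma lg_trans:
  "\<lbrakk>lgle G x y; lgle G y z; x \<in> carrier G; y \<in> carrier G; z \<in> carrier G\<rbrakk> \<Longrightarrow> lgle G x z"
  using ord.le_trans[of x y z] by (simp add: lorder_def)

lemma lg_pow_mono:
  assumes "x \<in> carrier G" "y \<in> carrier G" "lgle G x y"
  shows "lgle G (x [^] (n::nat)) (y [^] n)"
proof (induction n)
  case 0
  then show ?case by (simp add: lg_refl)
next
  case (Suc n)
  have "lgle G (x [^] n \<otimes> x) (x [^] n \<otimes> y)"
    using assms by (intro translation_mono) auto
  moreover have "lgle G (y \<otimes> x [^] n) (y \<otimes> y [^] n)"
    using assms Suc by (intro translation_mono) auto
  ultimately show ?case
    using assms lg_trans[of "x [^] n \<otimes> x" "x [^] n \<otimes> y" "y [^] n \<otimes> y"] by (simp add: m_comm)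
qed

lemma principal_lideal_self:
  assumes "x \<in> carrier G" shows "x \<in> principal_lideal G x"
proof -
  have "lgle G (labs G x) (labs G x [^] (1::nat))"
    using assms by (simp add: labs_closed lg_refl)
  then show ?thesis
    using assms unfolding principal_lideal_def by blast
qed

lemma principal_lideal_mono:
  assumes x: "x \<in> carrier G" and y: "y \<in> carrier G"
    and le: "lgle G (labs G x) (labs G y [^] (n::nat))"
  shows "principal_lideal G x \<subseteq> principal_lideal G y"
proof
  fix z assume "z \<in> principal_lideal G x"
  then obtain m :: nat where z: "z \<in> carrier G" and m: "lgle G (labs G z) (labs G x [^] m)"
    by (auto simp: principal_lideal_def)
  have "lgle G (labs G x [^] m) ((labs G y [^] n) [^] m)"
    using lg_pow_mono[OF _ _ le] x y by (simp add: labs_closed)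
  then have "lgle G (labs G z) (labs G y [^] (n * m))"
    using lg_trans[OF m] x y z by (simp add: labs_closed nat_pow_pow)
  then show "z \<in> principal_lideal G y"
    using z by (auto simp: principal_lideal_def)
qed

end

lemma Idc_map_principal:
  assumes G: "abelian_lgroup G" and H: "abelian_lgroup H" and f: "lhom G H f"
    and x: "x \<in> pos_cone G"
  shows "Idc_map G H f (principal_lideal G x) = principal_lideal H (f x)"
proof -
  interpret G: abelian_lgroup G by (fact G)
  interpret H: abelian_lgroup H by (fact H)
  have fhom: "f \<in> hom G H" and fj: "join_pres (lorder G) (lorder H) f"
    using f by (auto simp: lhom_def)
  interpret group_hom G H f
    by unfold_locales (fact fhom)
  have mono: "lgle H (f u) (f v)" if "u \<in> carrier G" "v \<in> carrier G" "lgle G u v" for u v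
  proof -
    have "isotone (lorder G) (lorder H) f"
      using fj by (intro join_pres_isotone) (auto simp: lorder_def)
    then show ?thesis
      using that by (auto simp: isotone_def lorder_def)
  qed
  have labs: "f (labs G u) = labs H (f u)" if "u \<in> carrier G" for u
    using fj that by (auto simp: join_pres_def labs_def lorder_def)
  have sub: "principal_lideal H (f u) \<subseteq> principal_lideal H (f v)"
    if u: "u \<in> carrier G" and v: "v \<in> carrier G"
      and "principal_lideal G u = principal_lideal G v" for u v
  proof -
    have "u \<in> principal_lideal G v"
      using G.principal_lideal_self[OF u] that(3) by simp
    then obtain n :: nat where "lgle G (labs G u) (labs G v [^]\<^bsub>G\<^esub> n)"
      by (auto simp: principal_lideal_def)
    from mono[OF _ _ this] have "lgle H (labs H (f u)) (labs H (f v) [^]\<^bsub>H\<^esub> n)"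
      using u v by (simp add: G.labs_closed labs hom_nat_pow)
    then show ?thesis
      using u v by (intro H.principal_lideal_mono) auto
  qed
  have eq: "principal_lideal H (f u) = principal_lideal H (f v)"
    if "u \<in> carrier G" "v \<in> carrier G" "principal_lideal G u = principal_lideal G v" for u v
    using sub[OF that] sub[OF that(2,1)] that(3) by auto
  show ?thesis
    unfolding Idc_map_def
  proof (rule the_equality)
    show "\<exists>y\<in>pos_cone G. principal_lideal G x = principal_lideal G y \<and>
        principal_lideal H (f x) = principal_lideal H (f y)"
      using x by blast
  next
    fix J
    assume "\<exists>y\<in>pos_cone G. principal_lideal G x = principal_lideal G y \<and>
        J = principal_lideal H (f y)"
    then show "J = principal_lideal H (f x)"
      using eq x by (auto simp: pos_cone_def)
  qed
qed

text \<open>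
  HOL has no existential quantifier over types. "There are Abelian \<open>\<ell>\<close>-groups \<open>G\<close> and \<open>H\<close>" is therefore
  expressed by letting the carriers be subsets of \<open>nat\<close> where existence is claimed, and of arbitrary
  types \<open>'g\<close>, \<open>'h\<close> where existence is assumed. Subsets of \<open>nat\<close> suffice since for countable \<open>K\<close>, \<open>L\<close>
  one can pass to countable \<open>\<ell>\<close>-subgroups containing a generator of every principal \<open>\<ell>\<close>-ideal.
\<close>

definition Idc_represents ::
  "('g, 'm) lgroup_scheme \<Rightarrow> ('h, 'n) lgroup_scheme \<Rightarrow> ('g \<Rightarrow> 'h) \<Rightarrow>
   ('g set \<Rightarrow> 'k::{distrib_lattice, bounded_lattice_bot}) \<Rightarrow>
   ('h set \<Rightarrow> 'l::{distrib_lattice, bounded_lattice_bot}) \<Rightarrow> ('k \<Rightarrow> 'l) \<Rightarrow> bool"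
where
  "Idc_represents G H f \<alpha> \<beta> \<phi> \<longleftrightarrow>
     abelian_lgroup G \<and> abelian_lgroup H \<and> lhom G H f \<and>
     lattice_iso (Idc G) type_order \<alpha> \<and> lattice_iso (Idc H) type_order \<beta> \<and>
     (\<forall>I\<in>carrier (Idc G). (\<phi> \<circ> \<alpha>) I = (\<beta> \<circ> Idc_map G H f) I)"

end

theory Submission
  imports Defs "HOL-Computational_Algebra.Polynomial" "HOL-Library.Function_Algebras"
begin

text \<open>
  A \<open>0\<close>-lattice homomorphism from \<open>Id\<^sub>c\<close> of a free Abelian \<open>\<ell>\<close>-group to \<open>L\<close> is
  determined by the images \<open>\<nu> f\<close> of the half-spaces \<open>f > 0\<close>, and by Farkas' lemma the maps
  that arise are those with \<open>\<nu> f \<and> \<nu> (- f) = 0\<close> and \<open>\<nu> (f + g) \<le> \<nu> f \<or> \<nu> g\<close>. So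
  polyhedral geometry can be avoided: at each prime ideal of \<open>L\<close> such a \<open>\<nu>\<close> is just a total
  preorder of a rational vector space.

  Given \<open>\<nu>\<close> on a space \<open>E\<close>, a new vector \<open>y\<close> is adjoined by choosing the values
  \<open>\<nu> (y - t)\<close> and \<open>\<nu> (t - y)\<close> for one \<open>t \<in> E\<close> after the other. Each time the conditions
  leave room for a largest candidate for either value, and complete normality makes the two candidates
  disjoint. If \<open>\<nu>\<close> is closed on \<open>E\<close>, then an instance \<open>\<nu> f \<le> \<nu> g \<or> x\<close> of closedness for the
  extension can be met by prescribing a small value at \<open>f - n g\<close> for a large \<open>n\<close>. Since everything is
  countable, closedness and surjectivity are achieved in the limit. Doing this first for \<open>K\<close>
  starting from the zero space, and then for \<open>L\<close> starting from the resulting valuation composed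
  with \<open>\<phi>\<close>, which is closed because \<open>\<phi>\<close> is, yields the two \<open>\<ell>\<close>-groups and the homomorphism.
\<close>

text \<open>The largest value allowed at a new \<open>t\<close> is a meet over the vectors already
  compared with \<open>y\<close>, and only finite nonempty meets are available. So \<open>y\<close>
  is never compared with all of \<open>E\<close> at once: finite stages are chained, chosen values
  stay frozen, and each closedness instance must be witnessed at a finite stage whatever is chosen
  later. As there may be no top element, each new value is chosen below an explicit cap; the same
  cap prescribes the small value that witnesses closedness. The group of a valuation is realised not
  as a quotient of a free one but by functions on the points of the lattice that are piecewise
  equivalent to vectors. Surjectivity makes every lattice element the support of a positive
  function, and closedness turns inclusion of supports into domination by a multiple; together they
  identify principal ideals with supports.\<close>

abbreviation join2 :: "'a::{distrib_lattice, bounded_lattice_bot} \<Rightarrow> 'a \<Rightarrow> 'a"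
    (infixl "\<curlyvee>" 65)
  where "x \<curlyvee> y \<equiv> sup_class.sup x y"

abbreviation meet2 :: "'a::{distrib_lattice, bounded_lattice_bot} \<Rightarrow> 'a \<Rightarrow> 'a"
    (infixl "\<curlywedge>" 70)
  where "x \<curlywedge> y \<equiv> inf_class.inf x y"

section \<open>Points of a distributive lattice with zero\<close>

text \<open>
  The complement of a point is a prime ideal. The constantly false map is a point as well, because a
  \<open>0\<close>-lattice homomorphism \<open>\<phi>\<close> need not be cofinal and pulling back along \<open>\<phi>\<close> must preserve points.
\<close>

definition point :: "('a::{distrib_lattice, bounded_lattice_bot} \<Rightarrow> bool) \<Rightarrow> bool" where
  "point P \<longleftrightarrow> \<not> P bot \<and> (\<forall>x y. P (x \<curlyvee> y) \<longleftrightarrow> P x \<or> P y) \<and> (\<forall>x y. P (x \<curlywedge> y) \<longleftrightarrow> P x \<and> P y)"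

lemma point_bot [simp]: "point P \<Longrightarrow> \<not> P bot"
  and point_sup [simp]: "point P \<Longrightarrow> P (x \<curlyvee> y) \<longleftrightarrow> P x \<or> P y"
  and point_inf [simp]: "point P \<Longrightarrow> P (x \<curlywedge> y) \<longleftrightarrow> P x \<and> P y"
  by (auto simp: point_def)

lemma point_mono: "point P \<Longrightarrow> x \<le> y \<Longrightarrow> P x \<Longrightarrow> P y"
  by (metis le_iff_sup point_sup)

lemma point_False: "point (\<lambda>_. False)"
  by (simp add: point_def)

text \<open>An ideal \<open>M\<close> maximal among those containing \<open>b\<close> and avoiding
  \<open>a\<close> is prime, and its complement is the point. Maximality enters as
  \<open>ext\<close>: any \<open>x\<close> outside \<open>M\<close> joins with a member of
  \<open>M\<close> to something above \<open>a\<close>.\<close>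

lemma point_separation:
  fixes a b :: "'a::{distrib_lattice, bounded_lattice_bot}"
  assumes "\<not> a \<le> b"
  obtains P where "point P" "P a" "\<not> P b"
proof -
  define ideals where "ideals = {I :: 'a set. b \<in> I \<and> a \<notin> I \<and>
    (\<forall>x y. y \<in> I \<longrightarrow> x \<le> y \<longrightarrow> x \<in> I) \<and> (\<forall>x\<in>I. \<forall>y\<in>I. x \<curlyvee> y \<in> I)}"
  have "{x. x \<le> b} \<in> ideals"
    using assms unfolding ideals_def by (simp add: order.trans)
  then have "\<exists>M\<in>ideals. \<forall>X\<in>ideals. M \<subseteq> X \<longrightarrow> X = M"
  proof (intro subset_Zorn_nonempty)
    fix \<C> assume C: "\<C> \<noteq> {}" "subset.chain ideals \<C>"
    then have sub: "\<C> \<subseteq> ideals" and lin: "\<And>X Y. X \<in> \<C> \<Longrightarrow> Y \<in> \<C> \<Longrightarrow> X \<subseteq> Y \<or> Y \<subseteq> X"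
      by (auto simp: subset.chain_def)
    have "x \<curlyvee> y \<in> \<Union>\<C>" if xy: "x \<in> X" "y \<in> Y" and XY: "X \<in> \<C>" "Y \<in> \<C>" for x y X Y
    proof (cases "X \<subseteq> Y")
      case True
      then have "x \<curlyvee> y \<in> Y" using xy XY sub unfolding ideals_def by blast
      then show ?thesis using XY by blast
    next
      case False
      then have "x \<curlyvee> y \<in> X" using lin[OF XY] xy XY sub unfolding ideals_def by blast
      then show ?thesis using XY by blast
    qed
    then have "\<forall>x\<in>\<Union>\<C>. \<forall>y\<in>\<Union>\<C>. x \<curlyvee> y \<in> \<Union>\<C>" by blast
    moreover have X: "b \<in> X" "a \<notin> X" "\<And>x y. y \<in> X \<Longrightarrow> x \<le> y \<Longrightarrow> x \<in> X" if "X \<in> \<C>" for X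
      using that sub unfolding ideals_def by blast+
    moreover have "\<forall>x y. y \<in> \<Union>\<C> \<longrightarrow> x \<le> y \<longrightarrow> x \<in> \<Union>\<C>" using X(3) by blast
    moreover have "b \<in> \<Union>\<C>" using X(1) C(1) by blast
    moreover have "a \<notin> \<Union>\<C>" using X(2) by blast
    ultimately show "\<Union>\<C> \<in> ideals"
      unfolding ideals_def by (intro CollectI conjI)
  qed blast
  then obtain M where M: "M \<in> ideals" and maxM: "\<And>X. X \<in> ideals \<Longrightarrow> M \<subseteq> X \<Longrightarrow> X = M"
    by blast
  have down: "\<And>x y. y \<in> M \<Longrightarrow> x \<le> y \<Longrightarrow> x \<in> M" and joinM: "\<And>x y. x \<in> M \<Longrightarrow> y \<in> M \<Longrightarrow> x \<curlyvee> y \<in> M"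
    and bM: "b \<in> M" and aM: "a \<notin> M"
    using M by (auto simp: ideals_def)
  have ext: "\<exists>m\<in>M. a \<le> m \<curlyvee> x" if "x \<notin> M" for x
  proof (rule ccontr)
    assume no: "\<not> ?thesis"
    let ?N = "{z. \<exists>m\<in>M. z \<le> m \<curlyvee> x}"
    have "u \<curlyvee> v \<in> ?N" if "u \<in> ?N" "v \<in> ?N" for u v
    proof -
      from that obtain m n where mn: "m \<in> M" "n \<in> M" "u \<le> m \<curlyvee> x" "v \<le> n \<curlyvee> x" by blast
      have "m \<curlyvee> x \<le> m \<curlyvee> n \<curlyvee> x" "n \<curlyvee> x \<le> m \<curlyvee> n \<curlyvee> x"
        by (simp_all add: le_supI1 le_supI2)
      then have "u \<curlyvee> v \<le> m \<curlyvee> n \<curlyvee> x"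
        using mn order_trans by (metis le_sup_iff)
      then show ?thesis using joinM mn by blast
    qed
    moreover have "M \<subseteq> ?N" by (auto intro: le_supI1)
    moreover have "u \<in> ?N" if "v \<in> ?N" "u \<le> v" for u v
      using that order.trans by blast
    ultimately have "?N \<in> ideals"
      using no bM unfolding ideals_def by blast
    then have "?N = M" using maxM \<open>M \<subseteq> ?N\<close> by blast
    moreover have "x \<in> ?N" using bM by auto
    ultimately show False using that by blast
  qed
  have prime: "x \<in> M \<or> y \<in> M" if xy: "x \<curlywedge> y \<in> M" for x y
  proof (rule ccontr)
    assume "\<not> ?thesis"
    then obtain m n where mn: "m \<in> M" "n \<in> M" "a \<le> m \<curlyvee> x" "a \<le> n \<curlyvee> y" using ext by blast
    have "m \<curlyvee> x \<le> m \<curlyvee> n \<curlyvee> x" "n \<curlyvee> y \<le> m \<curlyvee> n \<curlyvee> y"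
      by (simp_all add: le_supI1 le_supI2)
    then have "a \<le> (m \<curlyvee> n \<curlyvee> x) \<curlywedge> (m \<curlyvee> n \<curlyvee> y)"
      using mn(3,4) by (metis le_inf_iff order.trans)
    also have "\<dots> = m \<curlyvee> n \<curlyvee> (x \<curlywedge> y)" by (simp add: sup_inf_distrib1)
    finally have "a \<in> M" using down[OF joinM[OF joinM[OF mn(1,2)] xy]] by blast
    then show False using aM by blast
  qed
  have "point (\<lambda>x. x \<notin> M)"
    unfolding point_def
  proof (intro conjI allI)
    show "\<not> bot \<notin> M" using down[OF bM] by simp
    show "(x \<curlyvee> y \<notin> M) = (x \<notin> M \<or> y \<notin> M)" for x y using joinM down by (meson sup_ge1 sup_ge2)
    show "(x \<curlywedge> y \<notin> M) = (x \<notin> M \<and> y \<notin> M)" for x y using prime down by (meson inf_le1 inf_le2)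
  qed
  then show ?thesis using that aM bM by blast
qed

text \<open>Lattice inequalities become implications between truth values at one point. The
  combinatorics can thus be done in a totally preordered vector space and reassembled in the lattice
  afterwards.\<close>

lemma le_iff_points:
  "a \<le> b \<longleftrightarrow> (\<forall>P. point P \<longrightarrow> P a \<longrightarrow> P b)"
proof
  show "a \<le> b \<Longrightarrow> \<forall>P. point P \<longrightarrow> P a \<longrightarrow> P b" using point_mono by blast
  show "\<forall>P. point P \<longrightarrow> P a \<longrightarrow> P b \<Longrightarrow> a \<le> b" by (rule ccontr) (blast elim: point_separation)
qed

lemma eq_pointsI:
  fixes a b :: "'a::{distrib_lattice, bounded_lattice_bot}"
  assumes "\<And>P. point P \<Longrightarrow> P a = P b"
  shows "a = b"
  by (rule order.antisym) (use assms le_iff_points in blast)+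

lemma point_comp:
  assumes "zero_lattice_hom \<phi>" "point P" shows "point (P \<circ> \<phi>)"
proof -
  have \<phi>: "\<And>x y. \<phi> (x \<curlyvee> y) = \<phi> x \<curlyvee> \<phi> y" "\<And>x y. \<phi> (x \<curlywedge> y) = \<phi> x \<curlywedge> \<phi> y" "\<phi> bot = bot"
    using assms(1) unfolding zero_lattice_hom_def by blast+
  show ?thesis unfolding point_def o_apply \<phi> using assms(2) by simp
qed

text \<open>The index set is nonempty because there may be no top element to serve as the empty
  meet.\<close>

lemma finite_meet_exists:
  fixes u :: "'i \<Rightarrow> 'a::{distrib_lattice, bounded_lattice_bot}"
  assumes "finite I" "I \<noteq> {}"
  shows "\<exists>m. \<forall>P. point P \<longrightarrow> P m = (\<forall>i\<in>I. P (u i))"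
  using assms
proof (induction rule: finite_ne_induct)
  case (insert i I)
  then obtain m where "\<forall>P. point P \<longrightarrow> P m = (\<forall>i\<in>I. P (u i))" by blast
  then have "\<forall>P. point P \<longrightarrow> P (u i \<curlywedge> m) = (\<forall>i\<in>insert i I. P (u i))" by simp
  then show ?case by blast
qed auto

section \<open>Lattice-valued valuations\<close>

text \<open>\<open>rat poly\<close> is used as a concrete rational vector space with the countable
  basis \<open>monom 1 k\<close>.\<close>

definition subspace :: "rat poly set \<Rightarrow> bool" where
  "subspace E \<longleftrightarrow> 0 \<in> E \<and> (\<forall>u\<in>E. \<forall>v\<in>E. u + v \<in> E) \<and> (\<forall>c. \<forall>v\<in>E. smult c v \<in> E)"

lemma subspace_uminus: "subspace E \<Longrightarrow> v \<in> E \<Longrightarrow> - v \<in> E"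
  unfolding subspace_def by (metis smult_1_left smult_minus_left)

lemma subspace_diff: "subspace E \<Longrightarrow> u \<in> E \<Longrightarrow> v \<in> E \<Longrightarrow> u - v \<in> E"
  using subspace_uminus[of E v] unfolding subspace_def by (metis add_uminus_conv_diff)

lemmas subspace_rules =
  subspace_def[THEN iffD1, THEN conjunct1]
  subspace_def[THEN iffD1, THEN conjunct2, THEN conjunct1, rule_format]
  subspace_def[THEN iffD1, THEN conjunct2, THEN conjunct2, rule_format]
  subspace_uminus subspace_diff

text \<open>The strictly positive elements of a total preorder on \<open>E\<close> that is compatible with addition.\<close>

locale positive =
  fixes E :: "rat poly set" and pos :: "rat poly \<Rightarrow> bool"
  assumes E: "subspace E"
    and pos_asym: "v \<in> E \<Longrightarrow> pos v \<Longrightarrow> \<not> pos (- v)"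
    and pos_addD: "u \<in> E \<Longrightarrow> v \<in> E \<Longrightarrow> pos (u + v) \<Longrightarrow> pos u \<or> pos v"
begin

lemmas E_rules [simp, intro] = subspace_rules[OF E]

lemma not_pos_0 [simp]: "\<not> pos 0"
  using pos_asym[of 0] by auto

lemma pos_smult_nat: "v \<in> E \<Longrightarrow> n > 0 \<Longrightarrow> pos (smult (of_nat n) v) = pos v"
proof -
  assume v: "v \<in> E" and n: "n > 0"
  have le: "pos w" if "pos (smult (of_nat m) w)" "w \<in> E" for m w
    using that
  proof (induction m)
    case (Suc m)
    have "smult (of_nat (Suc m)) w = w + smult (of_nat m) w"
      by (simp add: smult_add_left)
    then show ?case using Suc pos_addD[of w "smult (of_nat m) w"] by auto
  qed auto
  show ?thesis
  proof
    assume p: "pos v"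
    obtain m where m: "n = Suc m" using n by (cases n) auto
    \<comment> \<open>With \<open>n = m + 1\<close>, the vector \<open>v\<close> is
      \<open>n v\<close> minus \<open>m v\<close>. If \<open>n v\<close> is not positive, then
      \<open>m (- v)\<close> is, and so is \<open>- v\<close> by \<open>le\<close>.\<close>
    have eq: "v = smult (of_nat n) v + smult (of_nat m) (- v)"
      unfolding m by (simp add: smult_add_left)
    show "pos (smult (of_nat n) v)"
    proof (rule ccontr)
      assume "\<not> ?thesis"
      then have "pos (smult (of_nat m) (- v))"
        using pos_addD[of "smult (of_nat n) v" "smult (of_nat m) (- v)"] eq p v by auto
      then show False using le[of m "- v"] pos_asym[OF v p] v by auto
    qed
  qed (use le v in blast)
qed

lemma not_pos_smult_nat: "\<not> pos v \<Longrightarrow> v \<in> E \<Longrightarrow> \<not> pos (smult (of_nat n) v)"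
  using pos_smult_nat[of v n] by (cases "n = 0") auto

lemma pos_smult:
  assumes "v \<in> E" "c > 0" shows "pos (smult c v) = pos v"
proof -
  obtain a b where ab: "quotient_of c = (a, b)" by fastforce
  then have b: "b > 0" and c: "c = of_int a / of_int b"
    by (simp_all add: quotient_of_denom_pos quotient_of_div)
  then have a: "a > 0" using assms(2) by (simp add: zero_less_divide_iff)
  have "pos (smult c v) = pos (smult (of_nat (nat b)) (smult c v))"
    using pos_smult_nat[of "smult c v" "nat b"] b assms by auto
  also have "smult (of_nat (nat b)) (smult c v) = smult (of_nat (nat a)) v"
    using a b c by simp
  also have "pos \<dots> = pos v"
    using pos_smult_nat[of v "nat a"] a assms by auto
  finally show ?thesis .
qed

end

text \<open>By \<open>le_iff_points\<close> this says that on a subspace \<open>\<nu> v\<close> and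
  \<open>\<nu> (- v)\<close> are disjoint and \<open>\<nu>\<close> is subadditive. The pointwise
  form lets every point be interpreted as an instance of \<open>positive\<close>.\<close>

definition valuation_on :: "rat poly set \<Rightarrow> (rat poly \<Rightarrow> 'l::{distrib_lattice, bounded_lattice_bot}) \<Rightarrow> bool"
  where "valuation_on E \<nu> \<longleftrightarrow> (\<forall>P. point P \<longrightarrow> positive E (P \<circ> \<nu>))"

text \<open>Look at the points where \<open>x\<close> fails and \<open>g \<ge> 0\<close>. If
  \<open>f > 0\<close> forces \<open>g > 0\<close> there, then a single \<open>n\<close> gives
  \<open>f \<le> n g\<close> at all of them. The term \<open>\<nu> (- g)\<close> discards the points
  where \<open>g\<close> is negative.\<close>

definition closed_on :: "rat poly set \<Rightarrow> (rat poly \<Rightarrow> 'l::{distrib_lattice, bounded_lattice_bot}) \<Rightarrow> bool"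
  where "closed_on E \<nu> \<longleftrightarrow> (\<forall>f\<in>E. \<forall>g\<in>E. \<forall>x. \<nu> f \<le> \<nu> g \<curlyvee> x \<longrightarrow>
    (\<exists>n::nat. \<nu> (f - smult (of_nat n) g) \<le> x \<curlyvee> \<nu> (- g)))"

section \<open>Adjoining one vector\<close>

text \<open>
  A new vector \<open>y\<close> is described by \<open>\<alpha> t = \<nu> (y - t)\<close> and \<open>\<beta> t = \<nu> (t - y)\<close> for \<open>t\<close> in a
  subset \<open>F\<close> of \<open>E\<close>; \<open>ext_val \<nu> \<alpha> \<beta> p e\<close> is the value of \<open>p y + e\<close>.
\<close>

definition root :: "rat \<Rightarrow> rat poly \<Rightarrow> rat poly" where
  "root p e = smult (- (1 / p)) e"

definition ext_val :: "(rat poly \<Rightarrow> 'b) \<Rightarrow> (rat poly \<Rightarrow> 'b) \<Rightarrow> (rat poly \<Rightarrow> 'b) \<Rightarrow> rat \<Rightarrow> rat poly \<Rightarrow> 'b"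
  where "ext_val \<nu> \<alpha> \<beta> p e =
    (if p > 0 then \<alpha> (root p e) else if p < 0 then \<beta> (root p e) else \<nu> e)"

lemma ext_val_comp: "P (ext_val \<nu> \<alpha> \<beta> p e) = ext_val (P \<circ> \<nu>) (P \<circ> \<alpha>) (P \<circ> \<beta>) p e"
  by (simp add: ext_val_def)

lemma root_uminus [simp]: "root (- p) (- e) = root p e" "root (- p) e = - root p e" "root p (- e) = - root p e"
  by (simp_all add: root_def)

lemma eval_root: "p \<noteq> 0 \<Longrightarrow> smult p t + e = smult p (t - root p e)"
  by (rule poly_eqI) (simp add: root_def field_simps)

lemma eval_root_neg: "p \<noteq> 0 \<Longrightarrow> smult p t + e = smult (- p) (root p e - t)"
  by (rule poly_eqI) (simp add: root_def field_simps)

text \<open>At a finite stage only comparisons of \<open>y\<close> with members of \<open>F\<close>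
  have been chosen; this condition says that the value of \<open>p y + e\<close> is determined by
  them.\<close>

definition rooted :: "rat poly set \<Rightarrow> rat poly set \<Rightarrow> rat \<Rightarrow> rat poly \<Rightarrow> bool" where
  "rooted E F p e \<longleftrightarrow> e \<in> E \<and> (p \<noteq> 0 \<longrightarrow> root p e \<in> F)"

text \<open>At one point, \<open>\<alpha> t\<close> reads \<open>t < y\<close> and
  \<open>\<beta> t\<close> reads \<open>y < t\<close>; if both fail, \<open>y\<close> is equivalent
  to \<open>t\<close>. The axioms are the laws of a total preorder for \<open>y\<close> and two
  members of \<open>F\<close>. For \<open>F = E\<close> they already imply subadditivity on all
  \<open>p y + e\<close>, see \<open>val_addD\<close>.\<close>

locale cut = positive +
  fixes F :: "rat poly set" and \<alpha> \<beta> :: "rat poly \<Rightarrow> bool"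
  assumes FE: "F \<subseteq> E"
    and asym: "t \<in> F \<Longrightarrow> \<alpha> t \<Longrightarrow> \<not> \<beta> t"
    and above: "s \<in> F \<Longrightarrow> t \<in> F \<Longrightarrow> \<alpha> t \<Longrightarrow> \<alpha> s \<or> pos (s - t)"
    and below: "s \<in> F \<Longrightarrow> t \<in> F \<Longrightarrow> \<beta> t \<Longrightarrow> \<beta> s \<or> pos (t - s)"
    and between: "s \<in> F \<Longrightarrow> t \<in> F \<Longrightarrow> pos (t - s) \<Longrightarrow> \<beta> t \<or> \<alpha> s"
begin

abbreviation val :: "rat \<Rightarrow> rat poly \<Rightarrow> bool" where "val \<equiv> ext_val pos \<alpha> \<beta>"

lemma FE' [simp]: "t \<in> F \<Longrightarrow> t \<in> E"
  using FE by blast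

lemma pos_eval:
  assumes "e \<in> E" "t \<in> E"
  shows "p > 0 \<Longrightarrow> pos (smult p t + e) = pos (t - root p e)"
    and "p < 0 \<Longrightarrow> pos (smult p t + e) = pos (root p e - t)"
proof -
  have r: "root p e \<in> E" using assms by (simp add: root_def)
  show "p > 0 \<Longrightarrow> pos (smult p t + e) = pos (t - root p e)"
    using eval_root[of p t e] pos_smult[of "t - root p e" p] assms r by auto
  show "p < 0 \<Longrightarrow> pos (smult p t + e) = pos (root p e - t)"
    using eval_root_neg[of p t e] pos_smult[of "root p e - t" "- p"] assms r by auto
qed

text \<open>This and the next four facts substitute a member \<open>t\<close> of \<open>F\<close>
  for \<open>y\<close>: \<open>\<not> \<alpha> t\<close> means \<open>y \<le> t\<close>,
  \<open>\<not> \<beta> t\<close> means \<open>t \<le> y\<close>, and \<open>p y + e\<close> is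
  monotone or antitone in \<open>y\<close> according to the sign of \<open>p\<close>.\<close>

lemma val_le:
  assumes "rooted E F p e" "t \<in> F" "p \<ge> 0" "\<not> \<alpha> t" "val p e"
  shows "pos (smult p t + e)"
  using assms above[of t "root p e"] by (cases "p = 0") (auto simp: ext_val_def rooted_def pos_eval)

lemma le_val:
  assumes "rooted E F p e" "t \<in> F" "p \<ge> 0" "\<not> \<beta> t" "pos (smult p t + e)"
  shows "val p e"
  using assms between[of "root p e" t] by (cases "p = 0") (auto simp: ext_val_def rooted_def pos_eval)

lemma val_le_neg:
  assumes "rooted E F p e" "t \<in> F" "p \<le> 0" "\<not> \<beta> t" "val p e"
  shows "pos (smult p t + e)"
  using assms below[of t "root p e"] by (cases "p = 0") (auto simp: ext_val_def rooted_def pos_eval)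

lemma le_val_neg:
  assumes "rooted E F p e" "t \<in> F" "p \<le> 0" "\<not> \<alpha> t" "pos (smult p t + e)"
  shows "val p e"
  using assms between[of t "root p e"] by (cases "p = 0") (auto simp: ext_val_def rooted_def pos_eval)

lemma val_less:
  assumes "rooted E F p e" "t \<in> F" "p > 0" "\<alpha> t" "\<not> val p e"
  shows "pos (- (smult p t + e))"
proof -
  have "pos (root p e - t)"
    using assms above[of "root p e" t] by (auto simp: ext_val_def rooted_def)
  moreover have "- (smult p t + e) = smult (- p) t + (- e)" by simp
  ultimately show ?thesis
    using assms pos_eval(2)[of "- e" t "- p"] by (auto simp: rooted_def)
qed

lemma val_asym:
  assumes "rooted E F p e" "val p e" shows "\<not> val (- p) (- e)"
  using assms asym pos_asym by (auto simp: ext_val_def rooted_def split: if_splits)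

text \<open>Replacing \<open>y\<close> by \<open>- y\<close> exchanges the two halves of the cut;
  later this disposes of the opposite signs of the coefficients.\<close>

lemma cut_dual: "cut E pos (uminus ` F) (\<lambda>t. \<beta> (- t)) (\<lambda>t. \<alpha> (- t))"
proof unfold_locales
  show "uminus ` F \<subseteq> E" by auto
  fix s t assume st: "s \<in> uminus ` F" "t \<in> uminus ` F"
  show "\<beta> (- t) \<Longrightarrow> \<beta> (- s) \<or> pos (s - t)"
    using st below[of "- s" "- t"] by auto
  show "\<alpha> (- t) \<Longrightarrow> \<alpha> (- s) \<or> pos (t - s)"
    using st above[of "- s" "- t"] by auto
  show "pos (t - s) \<Longrightarrow> \<alpha> (- t) \<or> \<beta> (- s)"
    using st between[of "- t" "- s"] by auto
qed (use asym in auto)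

lemma val_dual: "ext_val pos (\<lambda>t. \<beta> (- t)) (\<lambda>t. \<alpha> (- t)) (- p) e = val p e"
  by (simp add: ext_val_def)

text \<open>If both \<open>p y + e \<le> 0\<close> and \<open>q y + d \<le> 0\<close>, some
  \<open>t\<close> with \<open>y \<le> t\<close> satisfies both inequalities in place of
  \<open>y\<close>; adding them in \<open>E\<close> contradicts \<open>val_le\<close> for the sum.
  Such a \<open>t\<close> is the root of a summand with positive coefficient, and the smaller of the
  two roots if both coefficients are positive. These roots are in \<open>F\<close> because
  \<open>F = E\<close>.\<close>

lemma val_addD_pos:
  assumes F: "F = E" and ed: "e \<in> E" "d \<in> E" and pq: "p + q > 0" and v: "val (p + q) (e + d)"
  shows "val p e \<or> val q d"
proof (rule ccontr)
  assume neg: "\<not> ?thesis"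
  have r: "rooted E F a x" if "x \<in> E" for a x
    unfolding rooted_def using that by (simp add: F root_def)
  have rE: "root a x \<in> F" if "x \<in> E" for a x
    using that by (auto simp: F root_def)
  have key: "False" if t: "t \<in> F" "\<not> \<alpha> t" "\<not> pos (smult p t + e)" "\<not> pos (smult q t + d)" for t
  proof -
    have "pos (smult (p + q) t + (e + d))"
      using val_le[OF r t(1) _ t(2) v] ed pq by simp
    moreover have "smult (p + q) t + (e + d) = (smult p t + e) + (smult q t + d)"
      by (simp add: smult_add_left)
    ultimately show False
      using pos_addD[of "smult p t + e" "smult q t + d"] t ed by auto
  qed
  have root0: "smult a (root a x) + x = 0" if "a \<noteq> 0" for a x
    using that by (intro poly_eqI) (simp add: root_def)
  have one: "False" if p: "p > 0" and q: "q \<le> 0" and ed: "e \<in> E" "d \<in> E"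
    and neg: "\<not> val p e" "\<not> val q d"
    and key: "\<And>t. t \<in> F \<Longrightarrow> \<not> \<alpha> t \<Longrightarrow> \<not> pos (smult p t + e) \<Longrightarrow> \<not> pos (smult q t + d) \<Longrightarrow> False"
    for p q e d
  proof -
    have "\<not> \<alpha> (root p e)" using neg p by (simp add: ext_val_def)
    moreover from this have "\<not> pos (smult q (root p e) + d)"
      using le_val_neg[OF r, of d "root p e" q] rE ed neg q by auto
    ultimately show False using key[of "root p e"] rE ed root0[of p e] p by auto
  qed
  consider "p > 0" "q \<le> 0" | "q > 0" "p \<le> 0" | "p > 0" "q > 0" using pq by linarith
  then show False
  proof cases
    case 1 then show False using one[of p q e d] ed neg key by blast
  next
    case 2 then show False using one[of q p d e] ed neg key by blast
  next
    case 3
    have a: "\<not> \<alpha> (root p e)" "\<not> \<alpha> (root q d)" using neg 3 by (auto simp: ext_val_def)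
    show False
    proof (cases "pos (root p e - root q d)")
      case False
      then have "\<not> pos (smult q (root p e) + d)"
        using pos_eval(1)[of d "root p e" q] 3 ed rE F by auto
      then show False using key[of "root p e"] rE ed root0[of p e] 3 a by auto
    next
      case True
      then have "\<not> pos (root q d - root p e)"
        using pos_asym[of "root p e - root q d"] rE ed F by auto
      then have "\<not> pos (smult p (root q d) + e)"
        using pos_eval(1)[of e "root q d" p] 3 ed rE F by auto
      then show False using key[of "root q d"] rE ed root0[of q d] 3 a by auto
    qed
  qed
qed

end

lemma (in cut) val_addD:
  assumes F: "F = E" and ed: "e \<in> E" "d \<in> E" and v: "val (p + q) (e + d)"
  shows "val p e \<or> val q d"
proof -
  consider "p + q > 0" | "p + q < 0" | "p = 0" "q = 0" | "q = - p" "p > 0" | "p = - q" "q > 0" by linarith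
  then show ?thesis
  proof cases
    case 1 then show ?thesis using val_addD_pos assms by blast
  next
    case 2
    interpret dual: cut E pos "uminus ` F" "\<lambda>t. \<beta> (- t)" "\<lambda>t. \<alpha> (- t)" by (rule cut_dual)
    have "E \<subseteq> uminus ` E"
    proof
      fix x assume "x \<in> E"
      then show "x \<in> uminus ` E" by (intro image_eqI[of _ _ "- x"]) auto
    qed
    then have "uminus ` F = E" using F E_rules(4) by blast
    moreover have "dual.val (- p + - q) (e + d)"
      using v val_dual[of "p + q" "e + d"] by (simp only: minus_add_distrib)
    moreover have "- p + - q > 0" using 2 by linarith
    ultimately have "dual.val (- p) e \<or> dual.val (- q) d"
      using dual.val_addD_pos[of e d "- p" "- q"] ed by blast
    then show ?thesis by (simp only: val_dual)
  next
    case 3 then show ?thesis using v ed pos_addD by (simp add: ext_val_def)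
  next
    case 4
    \<comment> \<open>Here \<open>y\<close> cancels from the sum, which is a positive multiple of
      the difference of the two roots; \<open>between\<close> then places \<open>y\<close> relative
      to them.\<close>
    have eq: "e + d = smult p (root q d - root p e)"
      using 4 by (intro poly_eqI) (simp add: root_def field_simps)
    have "root q d \<in> E" "root p e \<in> E" using ed by (auto simp: root_def)
    then have "pos (root q d - root p e)" using v 4 eq by (simp add: ext_val_def pos_smult)
    then show ?thesis using between[of "root p e" "root q d"] 4 ed F by (auto simp: ext_val_def root_def)
  next
    case 5
    have eq: "e + d = smult q (root p e - root q d)"
      using 5 by (intro poly_eqI) (simp add: root_def field_simps)
    have "root q d \<in> E" "root p e \<in> E" using ed by (auto simp: root_def)
    then have "pos (root p e - root q d)" using v 5 eq by (simp add: ext_val_def pos_smult)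
    then show ?thesis using between[of "root q d" "root p e"] 5 ed F by (auto simp: ext_val_def root_def)
  qed
qed

section \<open>Inserting one more comparison into a cut\<close>

context cut
begin

text \<open>\<open>A\<close> and \<open>B\<close> are the largest values that the upper bounds, and
  for \<open>A\<close> also the cap \<open>C\<close>, allow at \<open>c\<close>; \<open>cap\<close>
  says that \<open>C\<close> respects the lower bounds. Shrinking \<open>A\<close> to
  \<open>x \<and> A\<close> and \<open>B\<close> to \<open>y \<and> B\<close> makes them disjoint.
  The lower bounds survive, since whatever is lost from one side lies in the other, whose upper
  bounds then do the work.\<close>

lemma cut_insert:
  assumes c: "c \<in> E" "c \<notin> F"
    and cap: "\<And>t. t \<in> F \<Longrightarrow> \<alpha> t \<Longrightarrow> C \<or> pos (c - t)" "\<And>t. t \<in> F \<Longrightarrow> pos (t - c) \<Longrightarrow> \<beta> t \<or> C"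
    and A: "A \<longleftrightarrow> C \<and> (\<forall>t\<in>F. \<alpha> t \<or> pos (t - c))"
    and B: "B \<longleftrightarrow> (\<forall>t\<in>F. \<beta> t \<or> pos (c - t))"
    and xy: "A \<or> B \<longleftrightarrow> A \<or> y" "A \<or> B \<longleftrightarrow> x \<or> B" "\<not> (x \<and> y)"
  shows "cut E pos (insert c F) (\<alpha>(c := x \<and> A)) (\<beta>(c := y \<and> B))"
proof -
  have tri: "pos (u - v) \<Longrightarrow> u \<in> E \<Longrightarrow> v \<in> E \<Longrightarrow> w \<in> E \<Longrightarrow> pos (u - w) \<or> pos (w - v)" for u v w
    using pos_addD[of "u - w" "w - v"] by auto
  have asymd: "pos (u - v) \<Longrightarrow> u \<in> E \<Longrightarrow> v \<in> E \<Longrightarrow> \<not> pos (v - u)" for u v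
    using pos_asym[of "u - v"] by auto
  have A1: "\<alpha> t \<Longrightarrow> A \<or> pos (c - t)" and A2: "pos (t - c) \<Longrightarrow> \<beta> t \<or> A"
    and B1: "\<beta> t \<Longrightarrow> B \<or> pos (t - c)" and B2: "pos (c - t) \<Longrightarrow> B \<or> \<alpha> t"
    if t: "t \<in> F" for t
  proof -
    show "\<alpha> t \<Longrightarrow> A \<or> pos (c - t)"
      using cap(1)[OF t] above[of _ t] t tri[of _ t c] c FE' A by blast
    show "pos (t - c) \<Longrightarrow> \<beta> t \<or> A"
      using cap(2)[OF t] between[of _ t] t tri[of t c] c FE' A by blast
    show "\<beta> t \<Longrightarrow> B \<or> pos (t - c)"
      using below[of _ t] t tri[of t _ c] c FE' B by blast
    show "pos (c - t) \<Longrightarrow> B \<or> \<alpha> t"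
      using between[of t] t tri[of c t] c FE' B by blast
  qed
  have A3: "A \<Longrightarrow> \<alpha> t \<or> pos (t - c)" and B3: "B \<Longrightarrow> \<beta> t \<or> pos (c - t)" if "t \<in> F" for t
    using A B that by blast+
  \<comment> \<open>If \<open>A\<close> holds without \<open>x\<close>, then \<open>B\<close> holds
    by \<open>xy\<close>, and \<open>B3\<close> together with asymmetry gives the remaining
    alternative. The other three facts follow the same pattern.\<close>
  have 1: "(x \<and> A) \<or> pos (c - t)" if "\<alpha> t" "t \<in> F" for t
    using A1[of t] B3[of t] asym[of t] that xy by blast
  have 2: "\<beta> t \<or> (x \<and> A)" if "pos (t - c)" "t \<in> F" for t
    using A2[of t] B3[of t] asymd[of t c] that xy c FE' by blast
  have 3: "(y \<and> B) \<or> pos (t - c)" if "\<beta> t" "t \<in> F" for t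
    using B1[of t] A3[of t] asym[of t] that xy by blast
  have 4: "(y \<and> B) \<or> \<alpha> t" if "pos (c - t)" "t \<in> F" for t
    using B2[of t] A3[of t] asymd[of t c] that xy c FE' by blast
  have ne: "t \<noteq> c" if "t \<in> F" for t using that c by blast
  show ?thesis
  proof unfold_locales
    fix s t assume s: "s \<in> insert c F" and t: "t \<in> insert c F"
    show "(\<alpha>(c := x \<and> A)) t \<Longrightarrow> (\<alpha>(c := x \<and> A)) s \<or> pos (s - t)"
      using s t 1 A3 above ne by (auto split: if_splits)
    show "(\<beta>(c := y \<and> B)) t \<Longrightarrow> (\<beta>(c := y \<and> B)) s \<or> pos (t - s)"
      using s t 3 B3 below ne by (auto split: if_splits)
    show "pos (t - s) \<Longrightarrow> (\<beta>(c := y \<and> B)) t \<or> (\<alpha>(c := x \<and> A)) s"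
      using s t 2 4 between ne by (auto split: if_splits)
  qed (use c FE xy(3) asym in \<open>auto split: if_splits\<close>)
qed

text \<open>Transfers the hypothesis "\<open>f > 0\<close> implies \<open>g > 0\<close> or
  \<open>X\<close>" from \<open>y\<close> to a vector \<open>t \<le> y\<close>, where
  \<open>f = p y + e\<close> and \<open>g = q y + d\<close> with \<open>g \<ge> 0\<close> at
  \<open>y\<close>. The result compares vectors of \<open>E\<close>, so that closedness on
  \<open>E\<close> can be applied. The sign condition makes \<open>g\<close> antitone in
  \<open>y\<close>.\<close>

lemma closedness_at:
  assumes pq: "q < 0 \<or> q = 0 \<and> p > 0" and r: "rooted E F p e" "rooted E F q d" and t: "t \<in> F"
    and le: "val p e \<Longrightarrow> val q d \<or> X" and neg: "\<not> X" "\<not> \<beta> t" "\<not> val (- q) (- d)"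
    and f: "pos (smult p t + e)"
  shows "pos (smult q t + d)"
proof (rule ccontr)
  assume g: "\<not> ?thesis"
  have q0: "q \<le> 0" using pq by auto
  have ng: "\<not> val q d" using val_le_neg[OF r(2) t q0 neg(2)] g by blast
  then have nf: "\<not> val p e" using le neg by blast
  show False
  proof (cases "p \<ge> 0")
    case True
    then show False using le_val[OF r(1) t True neg(2) f] nf by blast
  next
    case False
    then have q: "q < 0" using pq by auto
    have r': "rooted E F (- q) (- d)" using r by (auto simp: rooted_def)
    \<comment> \<open>As \<open>q < 0\<close> and \<open>g \<ge> 0\<close> at \<open>y\<close>,
      having \<open>t < y\<close> would make \<open>g\<close> strictly positive at \<open>t\<close>.
      So \<open>y\<close> is equivalent to \<open>t\<close>.\<close>
    have "\<not> \<alpha> t"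
    proof
      assume "\<alpha> t"
      then have "pos (- (smult (- q) t + (- d)))"
        using val_less[OF r' t _ _ neg(3)] q by auto
      then show False using g by (simp add: add.commute)
    qed
    then show False using le_val_neg[OF r(1) t _ _ f] nf False by auto
  qed
qed

text \<open>Since \<open>p - n q > 0\<close>, the vector \<open>f - n g\<close> is a positive
  multiple of \<open>y - c\<close>, so bounding its value means capping \<open>\<alpha>\<close> at
  \<open>c\<close>. The conclusions are the two conditions that \<open>cut_insert\<close> puts on
  the cap \<open>X \<or> val (- q) (- d)\<close>. They hold because \<open>h m\<close>, the value of
  \<open>f - m g\<close> at \<open>t\<close>, is not positive for any \<open>m \<ge> N\<close> once
  the excluded cases are set aside.\<close>

lemma closedness_caps:
  assumes pq: "q < 0 \<or> q = 0 \<and> p > 0" and r: "rooted E F p e" "rooted E F q d" and t: "t \<in> F"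
    and le: "val p e \<Longrightarrow> val q d \<or> X"
    and N: "pos (smult p t + e - smult (of_nat N) (smult q t + d))
      \<Longrightarrow> X \<or> \<beta> t \<or> val (- q) (- d) \<or> pos (- (smult q t + d))"
    and n: "N < n" and pos: "p - of_nat n * q > 0"
  defines "c \<equiv> root (p - of_nat n * q) (e - smult (of_nat n) d)"
  shows "\<alpha> t \<Longrightarrow> (X \<or> val (- q) (- d)) \<or> pos (c - t)"
    and "pos (t - c) \<Longrightarrow> \<beta> t \<or> X \<or> val (- q) (- d)"
proof -
  have ed: "e \<in> E" "d \<in> E" using r by (auto simp: rooted_def)
  have r': "rooted E F (- q) (- d)" using r by (auto simp: rooted_def)
  let ?f = "smult p t + e" and ?g = "smult q t + d"
  define h where "h m = ?f - smult (of_nat m) ?g" for m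
  have fg: "?f \<in> E" "?g \<in> E" and hE: "h m \<in> E" for m
    using t ed by (auto simp: h_def)
  have hn: "h n = smult (p - of_nat n * q) t + (e - smult (of_nat n) d)"
    by (rule poly_eqI) (simp add: h_def algebra_simps)
  have g0: "\<not> pos (- ?g)" if neg: "\<not> \<beta> t" "\<not> val (- q) (- d)"
  proof
    assume "pos (- ?g)"
    then have "pos (smult (- q) t + (- d))" by simp
    then show False using le_val[OF r' t _ neg(1)] pq neg by auto
  qed
  have hm: "\<not> pos (h m)" if neg: "\<not> X" "\<not> \<beta> t" "\<not> val (- q) (- d)" and m: "m \<ge> N" for m
  proof
    assume hm: "pos (h m)"
    have "h m = h N + smult (of_nat (m - N)) (- ?g)"
      using m by (intro poly_eqI) (simp add: h_def algebra_simps of_nat_diff)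
    moreover have "\<not> pos (smult (of_nat (m - N)) (- ?g))"
      by (rule not_pos_smult_nat[OF g0[OF neg(2,3)]]) (rule E_rules(4)[OF fg(2)])
    ultimately have "pos (h N)"
      using hm pos_addD[OF hE[of N] E_rules(3)[OF E_rules(4)[OF fg(2)], of "of_nat (m - N)"]] by metis
    then show False using N neg g0 unfolding h_def by blast
  qed
  have cE: "c \<in> E" using ed by (auto simp: c_def root_def)
  have hc: "pos (h n) = pos (t - c)"
    using pos_eval(1)[of "e - smult (of_nat n) d" t "p - of_nat n * q"] pos ed t unfolding hn c_def by auto
  have hc': "pos (- h n) = pos (c - t)"
  proof -
    have "- h n = smult (- (p - of_nat n * q)) t + (- (e - smult (of_nat n) d))"
      unfolding hn by (rule poly_eqI) (simp add: algebra_simps)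
    moreover have "root (- (p - of_nat n * q)) (- (e - smult (of_nat n) d)) = c"
      unfolding c_def by (simp only: root_uminus)
    ultimately show ?thesis
      using pos_eval(2)[of "- (e - smult (of_nat n) d)" t "- (p - of_nat n * q)"] pos ed t by auto
  qed
  show "pos (t - c) \<Longrightarrow> \<beta> t \<or> X \<or> val (- q) (- d)"
    using hm[of n] hc n by auto
  show "(X \<or> val (- q) (- d)) \<or> pos (c - t)" if a: "\<alpha> t"
  proof (rule ccontr)
    assume "\<not> ?thesis"
    then have X: "\<not> X" and vg: "\<not> val (- q) (- d)" and hn0: "\<not> pos (- h n)" using hc' by auto
    have b: "\<not> \<beta> t" using asym a t by blast
    \<comment> \<open>Strictness of \<open>N < n\<close> matters: \<open>n - 1 \<ge> N\<close> as
      well, so \<open>g\<close>, being \<open>h (n - 1) - h n\<close>, is at most zero at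
      \<open>t\<close>. This contradicts \<open>t < y\<close>, directly if \<open>q < 0\<close> and
      through \<open>f\<close> if \<open>q = 0\<close>.\<close>
    obtain k where k: "n = Suc k" "k \<ge> N" using n by (cases n) auto
    have gk: "?g = h k + (- h n)"
      unfolding k(1) by (intro poly_eqI) (simp add: h_def algebra_simps)
    have "\<not> pos (h k + (- h n))" using pos_addD[of "h k" "- h n"] hm[OF X b vg k(2)] hn0 hE by auto
    then have g: "\<not> pos ?g" using gk by simp
    show False
    proof (cases "q < 0")
      case True
      then have "pos (- (smult (- q) t + (- d)))"
        using val_less[OF r' t _ a vg] by auto
      then show False using g by (simp add: add.commute)
    next
      case False
      then have q: "q = 0" and p: "p > 0" using pq by auto
      have "\<not> pos (- ?f)"
      proof
        assume "pos (- ?f)"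
        moreover have "- ?f = - h n + smult (of_nat n) (- ?g)"
          by (intro poly_eqI) (simp add: h_def algebra_simps)
        moreover have "\<not> pos (smult (of_nat n) (- ?g))"
          by (rule not_pos_smult_nat[OF g0[OF b vg]]) (rule E_rules(4)[OF fg(2)])
        ultimately show False
          using pos_addD[OF E_rules(4)[OF hE[of n]] E_rules(3)[OF E_rules(4)[OF fg(2)], of "of_nat n"]] hn0
          by metis
      qed
      then have "val p e" using val_less[OF r(1) t p a] by blast
      then have "val q d" using le X by blast
      then show False using g q by (simp add: ext_val_def)
    qed
  qed
qed

end

section \<open>Lattice-valued cuts with finitely many comparisons\<close>

definition partial_ext ::
  "rat poly set \<Rightarrow> (rat poly \<Rightarrow> 'l::{distrib_lattice, bounded_lattice_bot}) \<Rightarrow> rat poly set \<Rightarrow>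
    (rat poly \<Rightarrow> 'l) \<Rightarrow> (rat poly \<Rightarrow> 'l) \<Rightarrow> bool" where
  "partial_ext E \<nu> F a b \<longleftrightarrow> (\<forall>P. point P \<longrightarrow> cut E (P \<circ> \<nu>) F (P \<circ> a) (P \<circ> b))"

text \<open>The constantly false point exists even in a one-element lattice, so facts that do not
  mention the point can always be extracted.\<close>

lemma partial_ext_subset:
  assumes "partial_ext E \<nu> F a b" shows "F \<subseteq> E" "subspace E"
  using assms[unfolded partial_ext_def, rule_format, OF point_False]
  unfolding cut_def cut_axioms_def positive_def by blast+

lemma partial_ext_dual:
  "partial_ext E \<nu> F a b \<Longrightarrow> partial_ext E \<nu> (uminus ` F) (\<lambda>t. b (- t)) (\<lambda>t. a (- t))"
  unfolding partial_ext_def using cut.cut_dual by (fastforce simp: o_def)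

text \<open>\<open>cut_insert\<close> at all points simultaneously: its candidates are meets over
  \<open>F\<close>, hence \<open>F\<close> finite and nonempty, and complete normality supplies
  \<open>x\<close> and \<open>y\<close>.\<close>

lemma add_point:
  fixes \<nu> :: "rat poly \<Rightarrow> 'l::{distrib_lattice, bounded_lattice_bot}"
  assumes cn: "completely_normal TYPE('l)"
    and ext: "partial_ext E \<nu> F a b" "finite F" "F \<noteq> {}" and c: "c \<in> E"
    and cap: "\<And>P t. point P \<Longrightarrow> t \<in> F \<Longrightarrow> P (a t) \<Longrightarrow> P C \<or> P (\<nu> (c - t))"
      "\<And>P t. point P \<Longrightarrow> t \<in> F \<Longrightarrow> P (\<nu> (t - c)) \<Longrightarrow> P (b t) \<or> P C"
  shows "\<exists>a' b'. partial_ext E \<nu> (insert c F) a' b' \<and> (\<forall>t\<in>F. a' t = a t \<and> b' t = b t) \<and> a' c \<le> C"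
proof (cases "c \<in> F")
  case True
  \<comment> \<open>Here \<open>c\<close> already has a value; the first cap condition at
    \<open>t = c\<close>, where \<open>\<nu> (c - c)\<close> vanishes, bounds it by
    \<open>C\<close>.\<close>
  have "P C" if P: "point P" "P (a c)" for P
  proof -
    interpret cut E "P \<circ> \<nu>" F "P \<circ> a" "P \<circ> b"
      using ext(1) P by (simp add: partial_ext_def)
    show ?thesis using cap(1)[OF P(1) True P(2)] not_pos_0 by simp
  qed
  then have "a c \<le> C" unfolding le_iff_points by blast
  then show ?thesis using True ext(1) by (metis insert_absorb)
next
  case False
  obtain mA where mA: "\<And>P. point P \<Longrightarrow> P mA = (\<forall>t\<in>F. P (a t \<curlyvee> \<nu> (t - c)))"
    using finite_meet_exists[OF ext(2,3), of "\<lambda>t. a t \<curlyvee> \<nu> (t - c)"] by blast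
  obtain B where B: "\<And>P. point P \<Longrightarrow> P B = (\<forall>t\<in>F. P (b t \<curlyvee> \<nu> (c - t)))"
    using finite_meet_exists[OF ext(2,3), of "\<lambda>t. b t \<curlyvee> \<nu> (c - t)"] by blast
  let ?A = "C \<curlywedge> mA"
  obtain x y where xy: "?A \<curlyvee> B = ?A \<curlyvee> y" "?A \<curlyvee> B = x \<curlyvee> B" "x \<curlywedge> y = bot"
    using cn unfolding completely_normal_def by blast
  have "cut E (P \<circ> \<nu>) (insert c F) (P \<circ> a(c := x \<curlywedge> ?A)) (P \<circ> b(c := y \<curlywedge> B))" if P: "point P" for P
  proof -
    interpret cut E "P \<circ> \<nu>" F "P \<circ> a" "P \<circ> b"
      using ext(1) P by (simp add: partial_ext_def)
    have xyP: "P ?A \<or> P B \<longleftrightarrow> P ?A \<or> P y" "P ?A \<or> P B \<longleftrightarrow> P x \<or> P B" "\<not> (P x \<and> P y)"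
      using xy P by (metis point_sup, metis point_sup, metis point_inf point_bot)
    have "cut E (P \<circ> \<nu>) (insert c F) ((P \<circ> a)(c := P x \<and> P ?A)) ((P \<circ> b)(c := P y \<and> P B))"
    proof (rule cut_insert)
      show "P ?A = (P C \<and> (\<forall>t\<in>F. (P \<circ> a) t \<or> (P \<circ> \<nu>) (t - c)))"
        using P mA by simp
      show "P B = (\<forall>t\<in>F. (P \<circ> b) t \<or> (P \<circ> \<nu>) (c - t))"
        using P B by simp
    qed (use c False xyP cap[OF P] in auto)
    moreover have "(P \<circ> a)(c := P x \<and> P ?A) = P \<circ> a(c := x \<curlywedge> ?A)"
      "(P \<circ> b)(c := P y \<and> P B) = P \<circ> b(c := y \<curlywedge> B)"
      using P by (auto simp: fun_eq_iff)
    ultimately show ?thesis by simp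
  qed
  then have "partial_ext E \<nu> (insert c F) (a(c := x \<curlywedge> ?A)) (b(c := y \<curlywedge> B))"
    by (simp add: partial_ext_def)
  moreover have "(a(c := x \<curlywedge> ?A)) c \<le> C" by (simp add: le_infI1 le_infI2)
  ultimately show ?thesis using False by (metis fun_upd_other)
qed

lemma add_point_uncapped:
  fixes \<nu> :: "rat poly \<Rightarrow> 'l::{distrib_lattice, bounded_lattice_bot}"
  assumes cn: "completely_normal TYPE('l)"
    and ext: "partial_ext E \<nu> F a b" "finite F" "F \<noteq> {}" and c: "c \<in> E"
  shows "\<exists>a' b'. partial_ext E \<nu> (insert c F) a' b' \<and> (\<forall>t\<in>F. a' t = a t \<and> b' t = b t)"
proof -
  obtain s where s: "s \<in> F" using ext by blast
  \<comment> \<open>Without a top element some cap has to be named; this one is the upper bound that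
    \<open>s\<close> imposes on the value at \<open>c\<close> anyway.\<close>
  let ?C = "a s \<curlyvee> \<nu> (s - c)"
  have "\<exists>a' b'. partial_ext E \<nu> (insert c F) a' b' \<and> (\<forall>t\<in>F. a' t = a t \<and> b' t = b t) \<and> a' c \<le> ?C"
  proof (rule add_point[OF cn ext c])
    fix P :: "'l \<Rightarrow> bool" and t assume P: "point P" and t: "t \<in> F"
    interpret cut E "P \<circ> \<nu>" F "P \<circ> a" "P \<circ> b"
      using ext(1) P by (simp add: partial_ext_def)
    show "P (a t) \<Longrightarrow> P ?C \<or> P (\<nu> (c - t))"
      using above[OF s t] pos_addD[of "s - c" "c - t"] s t c P by auto
    show "P (\<nu> (t - c)) \<Longrightarrow> P (b t) \<or> P ?C"
      using between[OF s t] pos_addD[of "t - s" "s - c"] s t c P by auto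
  qed
  then show ?thesis by blast
qed

text \<open>The signs make \<open>p - n q\<close> positive for large \<open>n\<close>, so a single
  new comparison fixes the value of \<open>f - n g\<close>. Each \<open>t\<close> in
  \<open>F\<close> contributes its own threshold from closedness on \<open>E\<close>, and finiteness
  of \<open>F\<close> permits a common \<open>n\<close>.\<close>

lemma meet_requirement_pos:
  fixes \<nu> :: "rat poly \<Rightarrow> 'l::{distrib_lattice, bounded_lattice_bot}"
  assumes cn: "completely_normal TYPE('l)" and closed: "closed_on E \<nu>"
    and ext: "partial_ext E \<nu> F a b" "finite F" "F \<noteq> {}"
    and pq: "q < 0 \<or> q = 0 \<and> p > 0" and r: "rooted E F p e" "rooted E F q d"
    and le: "ext_val \<nu> a b p e \<le> ext_val \<nu> a b q d \<curlyvee> x"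
  shows "\<exists>n a' b' c. partial_ext E \<nu> (insert c F) a' b' \<and> (\<forall>t\<in>F. a' t = a t \<and> b' t = b t) \<and>
    rooted E (insert c F) (p - of_nat n * q) (e - smult (of_nat n) d) \<and>
    ext_val \<nu> a' b' (p - of_nat n * q) (e - smult (of_nat n) d) \<le> x \<curlyvee> ext_val \<nu> a b (- q) (- d)"
proof -
  have E: "subspace E" and FE: "F \<subseteq> E" using partial_ext_subset[OF ext(1)] by auto
  have ed: "e \<in> E" "d \<in> E" using r by (auto simp: rooted_def)
  let ?v = "ext_val \<nu> a b"
  \<comment> \<open>Substituting \<open>t\<close> for \<open>y\<close> is paid for by joining to
    \<open>x\<close> the points where \<open>y < t\<close> and those where \<open>g\<close> is
    negative.\<close>
  have "\<exists>N. \<nu> (smult p t + e - smult (of_nat N) (smult q t + d))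
      \<le> x \<curlyvee> b t \<curlyvee> ?v (- q) (- d) \<curlyvee> \<nu> (- (smult q t + d))" if t: "t \<in> F" for t
  proof -
    have tE: "t \<in> E" using t FE by blast
    have "\<nu> (smult p t + e) \<le> \<nu> (smult q t + d) \<curlyvee> (x \<curlyvee> b t \<curlyvee> ?v (- q) (- d))"
      unfolding le_iff_points
    proof (intro allI impI)
      fix P assume P: "point P" and f: "P (\<nu> (smult p t + e))"
      interpret cut E "P \<circ> \<nu>" F "P \<circ> a" "P \<circ> b"
        using ext(1) P by (simp add: partial_ext_def)
      have le': "val p e \<Longrightarrow> val q d \<or> P x"
        using point_mono[OF P le] P by (simp add: ext_val_comp[of P \<nu> a b, symmetric])
      show "P (\<nu> (smult q t + d) \<curlyvee> (x \<curlyvee> b t \<curlyvee> ?v (- q) (- d)))"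
        using closedness_at[OF pq r t le'] P f by (auto simp: ext_val_comp[of P \<nu> a b, symmetric])
    qed
    moreover have "smult p t + e \<in> E" "smult q t + d \<in> E"
      using subspace_rules[OF E] tE ed by auto
    ultimately show ?thesis using closed unfolding closed_on_def by blast
  qed
  then obtain N where N: "\<And>t. t \<in> F \<Longrightarrow> \<nu> (smult p t + e - smult (of_nat (N t)) (smult q t + d))
      \<le> x \<curlyvee> b t \<curlyvee> ?v (- q) (- d) \<curlyvee> \<nu> (- (smult q t + d))" by metis
  have "\<exists>n0. \<forall>n\<ge>n0. p - of_nat n * q > 0"
  proof (cases "q < 0")
    case True
    obtain n0 :: nat where n0: "- p < of_nat n0 * (- q)"
      using ex_less_of_nat_mult[of "- q" "- p"] True by auto
    have "p - of_nat n * q > 0" if "n \<ge> n0" for n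
    proof -
      have "of_nat n0 * (- q) \<le> of_nat n * (- q)"
        using that True by (intro mult_right_mono) auto
      then show ?thesis using n0 by simp
    qed
    then show ?thesis by blast
  qed (use pq in auto)
  then obtain n0 where n0: "\<And>n. n \<ge> n0 \<Longrightarrow> p - of_nat n * q > 0" by blast
  \<comment> \<open>\<open>Suc\<close> gives the strict inequality wanted by
    \<open>closedness_caps\<close>; \<open>n0\<close> keeps the coefficient of \<open>y\<close>
    positive.\<close>
  define n where "n = Suc (max n0 (Max (N ` F)))"
  have nN: "N t < n" if "t \<in> F" for t
    using that ext(2) by (auto simp: n_def less_Suc_eq_le le_max_iff_disj)
  have pos: "p - of_nat n * q > 0" using n0[of n] by (simp add: n_def)
  let ?c = "root (p - of_nat n * q) (e - smult (of_nat n) d)"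
  let ?C = "x \<curlyvee> ?v (- q) (- d)"
  have hE: "e - smult (of_nat n) d \<in> E" and cE: "?c \<in> E"
    using subspace_rules[OF E] ed by (auto simp: root_def)
  have "\<exists>a' b'. partial_ext E \<nu> (insert ?c F) a' b' \<and> (\<forall>t\<in>F. a' t = a t \<and> b' t = b t) \<and> a' ?c \<le> ?C"
  proof (rule add_point[OF cn ext cE])
    fix P :: "'l \<Rightarrow> bool" and t assume P: "point P" and t: "t \<in> F"
    interpret cut E "P \<circ> \<nu>" F "P \<circ> a" "P \<circ> b"
      using ext(1) P by (simp add: partial_ext_def)
    have le': "val p e \<Longrightarrow> val q d \<or> P x"
      using point_mono[OF P le] P by (simp add: ext_val_comp[of P \<nu> a b, symmetric])
    have N': "(P \<circ> \<nu>) (smult p t + e - smult (of_nat (N t)) (smult q t + d))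
      \<Longrightarrow> P x \<or> (P \<circ> b) t \<or> val (- q) (- d) \<or> (P \<circ> \<nu>) (- (smult q t + d))"
      using point_mono[OF P N[OF t]] P by (auto simp: ext_val_comp[of P \<nu> a b, symmetric])
    note caps = closedness_caps[OF pq r t le' N' nN[OF t] pos]
    show "P (a t) \<Longrightarrow> P ?C \<or> P (\<nu> (?c - t))"
      using caps(1) P by (auto simp: ext_val_comp[of P \<nu> a b, symmetric])
    show "P (\<nu> (t - ?c)) \<Longrightarrow> P (b t) \<or> P ?C"
      using caps(2) P by (auto simp: ext_val_comp[of P \<nu> a b, symmetric])
  qed
  then obtain a' b' where "partial_ext E \<nu> (insert ?c F) a' b'" "\<forall>t\<in>F. a' t = a t \<and> b' t = b t"
    and c: "a' ?c \<le> ?C" by blast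
  moreover have "rooted E (insert ?c F) (p - of_nat n * q) (e - smult (of_nat n) d)"
    using hE by (simp add: rooted_def)
  moreover have "ext_val \<nu> a' b' (p - of_nat n * q) (e - smult (of_nat n) d) \<le> ?C"
    using c pos by (simp add: ext_val_def)
  ultimately show ?thesis by blast
qed

lemma ext_val_dual: "ext_val \<nu> (\<lambda>t. b (- t)) (\<lambda>t. a (- t)) (- p) e = ext_val \<nu> a b p e"
  by (simp add: ext_val_def)

lemma ext_val_cong:
  assumes "rooted E F p e" "\<forall>t\<in>F. a' t = a t \<and> b' t = b t"
  shows "ext_val \<nu> a' b' p e = ext_val \<nu> a b p e"
  using assms by (auto simp: ext_val_def rooted_def)

lemma rooted_mono: "rooted E F p e \<Longrightarrow> F \<subseteq> F' \<Longrightarrow> rooted E F' p e"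
  by (auto simp: rooted_def)

lemma rooted_dual: "rooted E F p e \<Longrightarrow> rooted E (uminus ` F) (- p) e"
  by (auto simp: rooted_def)

lemma rooted_uminus: "subspace E \<Longrightarrow> rooted E F p e \<Longrightarrow> rooted E F (- p) (- e)"
  by (auto simp: rooted_def subspace_rules)

text \<open>For the finite partial extension \<open>(F, a, b)\<close> the inequality \<open>\<nu> f \<le> \<nu> g \<or> x\<close>, where
  \<open>f = p y + e\<close> and \<open>g = q y + d\<close>, is already decided and is witnessed if it holds.\<close>

definition settled ::
  "rat poly set \<Rightarrow> (rat poly \<Rightarrow> 'l::{distrib_lattice, bounded_lattice_bot}) \<Rightarrow> rat poly set \<Rightarrow>
    (rat poly \<Rightarrow> 'l) \<Rightarrow> (rat poly \<Rightarrow> 'l) \<Rightarrow> rat \<times> rat poly \<times> rat \<times> rat poly \<times> 'l \<Rightarrow> bool" where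
  "settled E \<nu> F a b = (\<lambda>(p, e, q, d, x). rooted E F p e \<and> rooted E F q d \<and>
    (ext_val \<nu> a b p e \<le> ext_val \<nu> a b q d \<curlyvee> x \<longrightarrow>
      (\<exists>n::nat. rooted E F (p - of_nat n * q) (e - smult (of_nat n) d) \<and>
        ext_val \<nu> a b (p - of_nat n * q) (e - smult (of_nat n) d) \<le> x \<curlyvee> ext_val \<nu> a b (- q) (- d))))"

text \<open>Comparing \<open>y\<close> with the roots of \<open>f\<close> and \<open>g\<close>
  decides the inequality for good; if it holds, one capped comparison provides the witness. If
  \<open>p = q = 0\<close>, closedness on \<open>E\<close> suffices, and the remaining signs follow
  by duality.\<close>

lemma settle:
  fixes \<nu> :: "rat poly \<Rightarrow> 'l::{distrib_lattice, bounded_lattice_bot}"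
  assumes cn: "completely_normal TYPE('l)" and closed: "closed_on E \<nu>"
    and ext: "partial_ext E \<nu> F a b" "finite F" "F \<noteq> {}"
    and ed: "e \<in> E" "d \<in> E"
  shows "\<exists>F' a' b'. partial_ext E \<nu> F' a' b' \<and> finite F' \<and> F \<subseteq> F' \<and>
    (\<forall>t\<in>F. a' t = a t \<and> b' t = b t) \<and> settled E \<nu> F' a' b' (p, e, q, d, x)"
proof -
  have E: "subspace E" using partial_ext_subset[OF ext(1)] by auto
  have rE: "root p e \<in> E" "root q d \<in> E"
    using subspace_rules[OF E] ed by (auto simp: root_def)
  obtain a1 b1 where 1: "partial_ext E \<nu> (insert (root p e) F) a1 b1" "\<forall>t\<in>F. a1 t = a t \<and> b1 t = b t"
    using add_point_uncapped[OF cn ext rE(1)] by blast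
  let ?F = "insert (root q d) (insert (root p e) F)"
  obtain a2 b2 where 2: "partial_ext E \<nu> ?F a2 b2" "\<forall>t\<in>insert (root p e) F. a2 t = a1 t \<and> b2 t = b1 t"
    using add_point_uncapped[OF cn 1(1) _ _ rE(2)] ext by blast
  have F: "finite ?F" "?F \<noteq> {}" "F \<subseteq> ?F" using ext by auto
  have agree: "\<forall>t\<in>F. a2 t = a t \<and> b2 t = b t" using 1 2 by auto
  have r: "rooted E ?F p e" "rooted E ?F q d" using ed by (auto simp: rooted_def)
  note r' = rooted_uminus[OF E r(2)]
  let ?v = "ext_val \<nu> a2 b2"
  show ?thesis
  proof (cases "?v p e \<le> ?v q d \<curlyvee> x")
    case False
    then have "settled E \<nu> ?F a2 b2 (p, e, q, d, x)" using r by (simp add: settled_def)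
    then show ?thesis using 2(1) F agree by blast
  next
    case le: True
    have fin: ?thesis if "partial_ext E \<nu> (insert c ?F) a' b'" "\<forall>t\<in>?F. a' t = a2 t \<and> b' t = b2 t"
      "rooted E (insert c ?F) (p - of_nat n * q) (e - smult (of_nat n) d)"
      "ext_val \<nu> a' b' (p - of_nat n * q) (e - smult (of_nat n) d) \<le> x \<curlyvee> ?v (- q) (- d)"
      for a' b' c and n :: nat
    proof -
      have cap: "ext_val \<nu> a' b' (p - of_nat n * q) (e - smult (of_nat n) d)
          \<le> x \<curlyvee> ext_val \<nu> a' b' (- q) (- d)"
        using that(4) ext_val_cong[OF r' that(2)] by (simp only:)
      have "settled E \<nu> (insert c ?F) a' b' (p, e, q, d, x)"
        unfolding settled_def split
        using rooted_mono[OF r(1) subset_insertI[of ?F c]] rooted_mono[OF r(2) subset_insertI[of ?F c]]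
          that(3) cap by blast
      moreover have "\<forall>t\<in>F. a' t = a t \<and> b' t = b t" using agree that(2) by auto
      ultimately show ?thesis using that(1) F by (metis finite_insert subset_insertI2)
    qed
    consider "q < 0 \<or> q = 0 \<and> p > 0" | "q > 0 \<or> q = 0 \<and> p < 0" | "p = 0" "q = 0" by linarith
    then show ?thesis
    proof cases
      case 1
      then show ?thesis using meet_requirement_pos[OF cn closed 2(1) F(1,2) 1 r le] fin by blast
    next
      case 3
      have "\<nu> e \<le> \<nu> d \<curlyvee> x" using le 3 by (simp add: ext_val_def)
      then obtain n :: nat where "\<nu> (e - smult (of_nat n) d) \<le> x \<curlyvee> \<nu> (- d)"
        using closed ed unfolding closed_on_def by blast
      then have "settled E \<nu> ?F a2 b2 (p, e, q, d, x)"
        using r 3 E ed by (auto simp: settled_def ext_val_def rooted_def subspace_rules)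
      then show ?thesis using 2(1) F agree by blast
    next
      case neg: 2
      let ?a = "\<lambda>t. b2 (- t)" and ?b = "\<lambda>t. a2 (- t)"
      have le': "ext_val \<nu> ?a ?b (- p) e \<le> ext_val \<nu> ?a ?b (- q) d \<curlyvee> x"
        using le by (simp only: ext_val_dual)
      have F': "finite (uminus ` ?F)" "uminus ` ?F \<noteq> {}" using F by auto
      have neg': "- q < 0 \<or> - q = 0 \<and> - p > 0" using neg by auto
      obtain n :: nat and a' b' c where
        ext': "partial_ext E \<nu> (insert c (uminus ` ?F)) a' b'"
        and agree': "\<forall>t\<in>uminus ` ?F. a' t = ?a t \<and> b' t = ?b t"
        and r'': "rooted E (insert c (uminus ` ?F)) (- p - of_nat n * - q) (e - smult (of_nat n) d)"
        and cap: "ext_val \<nu> a' b' (- p - of_nat n * - q) (e - smult (of_nat n) d)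
          \<le> x \<curlyvee> ext_val \<nu> ?a ?b (- (- q)) (- d)"
        using meet_requirement_pos[OF cn closed partial_ext_dual[OF 2(1)] F' neg'
            rooted_dual[OF r(1)] rooted_dual[OF r(2)] le'] by blast
      have img: "uminus ` insert c (uminus ` ?F) = insert (- c) ?F"
        by (simp add: image_image)
      have sgn: "- (- p - of_nat n * - q) = p - of_nat n * q" by simp
      show ?thesis
      proof (rule fin)
        show "partial_ext E \<nu> (insert (- c) ?F) (\<lambda>t. b' (- t)) (\<lambda>t. a' (- t))"
          using partial_ext_dual[OF ext'] by (simp only: img)
        show "\<forall>t\<in>?F. b' (- t) = a2 t \<and> a' (- t) = b2 t"
          using agree' by auto
        show "rooted E (insert (- c) ?F) (p - of_nat n * q) (e - smult (of_nat n) d)"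
          using rooted_dual[OF r''] by (simp only: img sgn)
        show "ext_val \<nu> (\<lambda>t. b' (- t)) (\<lambda>t. a' (- t)) (p - of_nat n * q) (e - smult (of_nat n) d)
          \<le> x \<curlyvee> ?v (- q) (- d)"
          using cap ext_val_dual[of \<nu> b' a' "- p - of_nat n * - q" "e - smult (of_nat n) d"]
            ext_val_dual[of \<nu> b2 a2 "- q" "- d"] by (simp only: sgn)
      qed
    qed
  qed
qed

section \<open>The limit of the finite stages\<close>

lemma countable_rat_poly: "countable (UNIV :: rat poly set)"
proof -
  have "(UNIV :: rat poly set) = range Poly"
    by (metis Poly_coeffs surjI)
  then show ?thesis by (metis countable_image countableI_type)
qed

lemma cut_agree:
  assumes "cut E pos F \<alpha> \<beta>" "\<forall>t\<in>F. \<alpha>' t = \<alpha> t \<and> \<beta>' t = \<beta> t"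
  shows "cut E pos F \<alpha>' \<beta>'"
proof -
  interpret cut E pos F \<alpha> \<beta> by (rule assms)
  show ?thesis
    by unfold_locales (use assms(2) FE asym above below between in auto)
qed

text \<open>All closedness instances are enumerated and settled one per stage. Values on earlier
  comparisons never change, so a settled instance stays settled and passes to the limit.\<close>

lemma adjoin_vector:
  fixes \<nu> :: "rat poly \<Rightarrow> 'l::{distrib_lattice, bounded_lattice_bot}"
  assumes cn: "completely_normal TYPE('l)" and count: "countable (UNIV :: 'l set)"
    and E: "subspace E" and val: "valuation_on E \<nu>" and closed: "closed_on E \<nu>"
  shows "\<exists>a b. partial_ext E \<nu> E a b \<and> a 0 = z \<and>
    (\<forall>p e q d x. e \<in> E \<longrightarrow> d \<in> E \<longrightarrow> ext_val \<nu> a b p e \<le> ext_val \<nu> a b q d \<curlyvee> x \<longrightarrow>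
      (\<exists>n::nat. ext_val \<nu> a b (p - of_nat n * q) (e - smult (of_nat n) d)
        \<le> x \<curlyvee> ext_val \<nu> a b (- q) (- d)))"
proof -
  define R where "R = {(p :: rat, e, q :: rat, d, x :: 'l). e \<in> E \<and> d \<in> E}"
  have "countable (UNIV \<times> UNIV \<times> UNIV \<times> UNIV \<times> UNIV :: (rat \<times> rat poly \<times> rat \<times> rat poly \<times> 'l) set)"
    using countable_rat_poly count by (intro countable_SIGMA) auto
  then have "countable R" by (rule countable_subset[rotated]) auto
  moreover have zE: "0 \<in> E" using E by (simp add: subspace_def)
  then have "(0, 0, 0, 0, bot) \<in> R" by (simp add: R_def)
  ultimately obtain r :: "nat \<Rightarrow> rat \<times> rat poly \<times> rat \<times> rat poly \<times> 'l" where r: "range r = R"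
    by (metis empty_iff range_from_nat_into)
  define stage where "stage = (\<lambda>(F, a, b). partial_ext E \<nu> F a b \<and> finite F \<and> 0 \<in> F \<and> a 0 = z)"
  define next_stage where "next_stage n = (\<lambda>(F, a, b) (F', a', b'). F \<subseteq> F' \<and>
    (\<forall>t\<in>F. a' t = a t \<and> b' t = b t) \<and> settled E \<nu> F' a' b' (r n))" for n
  \<comment> \<open>A single comparison, with \<open>0\<close>, obeys no constraint but
    disjointness; with \<open>bot\<close> on the other side, \<open>z\<close> is arbitrary. This
    freedom later yields surjectivity.\<close>
  have init: "stage ({0}, \<lambda>_. z, \<lambda>_. bot)"
  proof -
    have "cut E (P \<circ> \<nu>) {0} (P \<circ> (\<lambda>_. z)) (P \<circ> (\<lambda>_. bot))" if P: "point P" for P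
    proof -
      interpret positive E "P \<circ> \<nu>" using val P by (simp add: valuation_on_def)
      show ?thesis using P not_pos_0 by unfold_locales auto
    qed
    then show ?thesis by (simp add: stage_def partial_ext_def)
  qed
  have step: "\<exists>\<sigma>'. stage \<sigma>' \<and> next_stage n \<sigma> \<sigma>'" if st: "stage \<sigma>" for \<sigma> n
  proof -
    obtain F a b where \<sigma>: "\<sigma> = (F, a, b)" by (cases \<sigma>)
    obtain p e q d x where rn: "r n = (p, e, q, d, x)" by (cases "r n")
    have "r n \<in> R" using r by blast
    then have ed: "e \<in> E" "d \<in> E" using rn by (auto simp: R_def)
    have F: "partial_ext E \<nu> F a b" "finite F" "F \<noteq> {}" "0 \<in> F" "a 0 = z"
      using st \<sigma> by (auto simp: stage_def)
    obtain F' a' b' where "partial_ext E \<nu> F' a' b'" "finite F'" "F \<subseteq> F'"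
      "\<forall>t\<in>F. a' t = a t \<and> b' t = b t" "settled E \<nu> F' a' b' (r n)"
      using settle[OF cn closed F(1-3) ed, of p q x] rn by auto
    then have "stage (F', a', b') \<and> next_stage n \<sigma> (F', a', b')"
      using F \<sigma> by (auto simp: stage_def next_stage_def)
    then show ?thesis by blast
  qed
  obtain \<sigma> where \<sigma>: "\<And>n. stage (\<sigma> n)" "\<And>n. next_stage n (\<sigma> n) (\<sigma> (Suc n))"
    using dependent_nat_choice[of "\<lambda>_. stage" next_stage] init step by metis
  define F where "F n = fst (\<sigma> n)" for n
  define A where "A n = fst (snd (\<sigma> n))" for n
  define B where "B n = snd (snd (\<sigma> n))" for n
  have st: "partial_ext E \<nu> (F n) (A n) (B n)" "0 \<in> F n" "A n 0 = z" for n
    using \<sigma>(1)[of n] by (auto simp: stage_def F_def A_def B_def split: prod.splits)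
  have nx: "F n \<subseteq> F (Suc n)" "\<forall>t\<in>F n. A (Suc n) t = A n t \<and> B (Suc n) t = B n t"
    "settled E \<nu> (F (Suc n)) (A (Suc n)) (B (Suc n)) (r n)" for n
    using \<sigma>(2)[of n] by (auto simp: next_stage_def F_def A_def B_def split: prod.splits)
  have agree: "F m \<subseteq> F n \<and> (\<forall>t\<in>F m. A n t = A m t \<and> B n t = B m t)" if "m \<le> n" for m n
    using that
  proof (induction rule: dec_induct)
    case (step n)
    then show ?case using nx(1,2)[of n] by (metis order.trans subsetD)
  qed simp
  have FE: "F n \<subseteq> E" for n using partial_ext_subset[OF st(1)] by blast
  have cover: "\<exists>n. t \<in> F n" if "t \<in> E" for t
  proof -
    \<comment> \<open>The root of \<open>y - t\<close> is \<open>t\<close>, so settling this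
      instance forces \<open>t\<close> into some stage.\<close>
    have "(1, - t, 0, 0, bot) \<in> R" using that zE subspace_rules[OF E] by (auto simp: R_def)
    then obtain n where "r n = (1, - t, 0, 0, bot)" using r by (metis imageE)
    then have "t \<in> F (Suc n)"
      using nx(3)[of n] by (simp add: settled_def rooted_def root_def)
    then show ?thesis by blast
  qed
  define a where "a t = A (LEAST n. t \<in> F n) t" for t
  define b where "b t = B (LEAST n. t \<in> F n) t" for t
  have lim: "\<forall>t\<in>F n. a t = A n t \<and> b t = B n t" for n
  proof
    fix t assume t: "t \<in> F n"
    have "t \<in> F (LEAST n. t \<in> F n)" "(LEAST n. t \<in> F n) \<le> n"
      using t by (auto intro: LeastI Least_le)
    then show "a t = A n t \<and> b t = B n t" using agree unfolding a_def b_def by metis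
  qed
  have "cut E (P \<circ> \<nu>) E (P \<circ> a) (P \<circ> b)" if P: "point P" for P
  proof -
    have c: "cut E (P \<circ> \<nu>) (F n) (P \<circ> a) (P \<circ> b)" for n
      using cut_agree[of E "P \<circ> \<nu>" "F n" "P \<circ> A n" "P \<circ> B n" "P \<circ> a" "P \<circ> b"] st(1)[of n] P lim[of n]
      by (simp add: partial_ext_def)
    have both: "\<exists>n. s \<in> F n \<and> t \<in> F n" if st: "s \<in> E" "t \<in> E" for s t
    proof -
      obtain m n where "s \<in> F m" "t \<in> F n" using cover[OF st(1)] cover[OF st(2)] by blast
      then have "s \<in> F (max m n)" "t \<in> F (max m n)"
        using agree[of m "max m n"] agree[of n "max m n"] by auto
      then show ?thesis by blast
    qed
    interpret positive E "P \<circ> \<nu>" using val P by (simp add: valuation_on_def)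
    show ?thesis
    proof unfold_locales
      fix s t assume "s \<in> E" "t \<in> E"
      then obtain n where n: "s \<in> F n" "t \<in> F n" using both by blast
      interpret c: cut E "P \<circ> \<nu>" "F n" "P \<circ> a" "P \<circ> b" by (rule c)
      show "(P \<circ> a) t \<Longrightarrow> \<not> (P \<circ> b) t" by (rule c.asym[OF n(2)])
      show "(P \<circ> a) t \<Longrightarrow> (P \<circ> a) s \<or> (P \<circ> \<nu>) (s - t)" by (rule c.above[OF n])
      show "(P \<circ> b) t \<Longrightarrow> (P \<circ> b) s \<or> (P \<circ> \<nu>) (t - s)" by (rule c.below[OF n])
      show "(P \<circ> \<nu>) (t - s) \<Longrightarrow> (P \<circ> b) t \<or> (P \<circ> a) s" by (rule c.between[OF n])
    qed simp
  qed
  then have "partial_ext E \<nu> E a b" by (simp add: partial_ext_def)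
  moreover have "a 0 = z" using lim[of 0] st[of 0] by auto
  moreover have "\<exists>n::nat. ext_val \<nu> a b (p - of_nat n * q) (e - smult (of_nat n) d)
        \<le> x \<curlyvee> ext_val \<nu> a b (- q) (- d)"
    if ed: "e \<in> E" "d \<in> E" and le: "ext_val \<nu> a b p e \<le> ext_val \<nu> a b q d \<curlyvee> x" for p e q d x
  proof -
    have "(p, e, q, d, x) \<in> R" using ed by (simp add: R_def)
    then obtain n where "r n = (p, e, q, d, x)" using r by (metis imageE)
    then have s: "settled E \<nu> (F (Suc n)) (A (Suc n)) (B (Suc n)) (p, e, q, d, x)"
      using nx(3)[of n] by simp
    note cong = ext_val_cong[OF _ lim[of "Suc n"], of E _ _ \<nu>]
    have r: "rooted E (F (Suc n)) p e" "rooted E (F (Suc n)) q d" using s by (auto simp: settled_def)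
    obtain m :: nat where "rooted E (F (Suc n)) (p - of_nat m * q) (e - smult (of_nat m) d)"
      "ext_val \<nu> (A (Suc n)) (B (Suc n)) (p - of_nat m * q) (e - smult (of_nat m) d)
        \<le> x \<curlyvee> ext_val \<nu> (A (Suc n)) (B (Suc n)) (- q) (- d)"
      using s le cong[OF r(1)] cong[OF r(2)] unfolding settled_def by auto
    then show ?thesis using cong cong[OF rooted_uminus[OF E r(2)]] by metis
  qed
  ultimately show ?thesis by blast
qed

section \<open>Adjoining the basis vectors in turn\<close>

lemma adjoin_monom:
  fixes \<nu> :: "rat poly \<Rightarrow> 'l::{distrib_lattice, bounded_lattice_bot}"
  assumes cn: "completely_normal TYPE('l)" and count: "countable (UNIV :: 'l set)"
    and E: "subspace E" and val: "valuation_on E \<nu>" and closed: "closed_on E \<nu>"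
    and k: "\<And>v. v \<in> E \<Longrightarrow> coeff v k = 0"
  defines "E' \<equiv> {v. v - monom (coeff v k) k \<in> E}"
  shows "\<exists>\<nu>'. valuation_on E' \<nu>' \<and> closed_on E' \<nu>' \<and> (\<forall>v\<in>E. \<nu>' v = \<nu> v) \<and> \<nu>' (monom 1 k) = z"
proof -
  \<comment> \<open>Each \<open>v\<close> in \<open>E'\<close> splits as \<open>coeff v k\<close>
    times the new vector \<open>monom 1 k\<close> plus \<open>rest v\<close> in
    \<open>E\<close>.\<close>
  define rest where "rest v = v - monom (coeff v k) k" for v :: "rat poly"
  have rest: "rest (u + v) = rest u + rest v" "rest (- v) = - rest v" "rest (smult c v) = smult c (rest v)"
    "rest (u - v) = rest u - rest v" for u v c
    by (rule poly_eqI, simp add: rest_def algebra_simps)+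
  have E': "v \<in> E' \<longleftrightarrow> rest v \<in> E" for v by (simp add: E'_def rest_def)
  have subE': "subspace E'"
    using subspace_rules[OF E] by (auto simp: subspace_def E' rest) (simp add: rest_def)
  obtain a b where ext: "partial_ext E \<nu> E a b" and a0: "a 0 = z"
    and cl: "\<And>p e q d x. e \<in> E \<Longrightarrow> d \<in> E \<Longrightarrow> ext_val \<nu> a b p e \<le> ext_val \<nu> a b q d \<curlyvee> x \<Longrightarrow>
      (\<exists>n::nat. ext_val \<nu> a b (p - of_nat n * q) (e - smult (of_nat n) d)
        \<le> x \<curlyvee> ext_val \<nu> a b (- q) (- d))"
    using adjoin_vector[OF cn count E val closed, of z] by blast
  define \<nu>' where "\<nu>' v = ext_val \<nu> a b (coeff v k) (rest v)" for v
  have "positive E' (P \<circ> \<nu>')" if P: "point P" for P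
  proof -
    interpret cut E "P \<circ> \<nu>" E "P \<circ> a" "P \<circ> b" using ext P by (simp add: partial_ext_def)
    have \<nu>': "(P \<circ> \<nu>') v = val (coeff v k) (rest v)" for v
      by (simp add: \<nu>'_def ext_val_comp[of P \<nu> a b])
    have r: "rooted E E p e" if "e \<in> E" for p e using that by (simp add: rooted_def root_def)
    show ?thesis
    proof
      show "subspace E'" by (rule subE')
      show "\<not> (P \<circ> \<nu>') (- v)" if "v \<in> E'" "(P \<circ> \<nu>') v" for v
        using val_asym[OF r] that unfolding \<nu>' E' by (simp add: rest)
      show "(P \<circ> \<nu>') u \<or> (P \<circ> \<nu>') v" if "u \<in> E'" "v \<in> E'" "(P \<circ> \<nu>') (u + v)" for u v
        using val_addD[OF refl] that unfolding \<nu>' E' by (simp add: rest)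
    qed
  qed
  then have "valuation_on E' \<nu>'" by (simp add: valuation_on_def)
  moreover have "closed_on E' \<nu>'"
    unfolding closed_on_def
  proof (intro ballI allI impI)
    fix f g x assume "f \<in> E'" "g \<in> E'" and le: "\<nu>' f \<le> \<nu>' g \<curlyvee> x"
    then have "rest f \<in> E" "rest g \<in> E" by (simp_all add: E')
    from cl[OF this le[unfolded \<nu>'_def]]
    show "\<exists>n::nat. \<nu>' (f - smult (of_nat n) g) \<le> x \<curlyvee> \<nu>' (- g)"
      by (simp add: \<nu>'_def rest)
  qed
  moreover have "\<nu>' v = \<nu> v" if "v \<in> E" for v
    using k[OF that] by (simp add: \<nu>'_def rest_def ext_val_def)
  moreover have "\<nu>' (monom 1 k) = z"
    using a0 by (simp add: \<nu>'_def rest_def ext_val_def root_def)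
  ultimately show ?thesis by blast
qed

text \<open>Coordinates in \<open>S\<close> are present from the start; the others join in
  increasing order as \<open>k\<close> grows.\<close>

definition span_upto :: "nat set \<Rightarrow> nat \<Rightarrow> rat poly set" where
  "span_upto S k = {v. \<forall>i. coeff v i \<noteq> 0 \<longrightarrow> i \<in> S \<or> i < k}"

lemma subspace_span_upto: "subspace (span_upto S k)"
  unfolding subspace_def span_upto_def by (auto; metis add.right_neutral)

lemma span_upto_mono: "k \<le> m \<Longrightarrow> span_upto S k \<subseteq> span_upto S m"
  by (fastforce simp: span_upto_def)

lemma mem_span_upto: "degree v < k \<Longrightarrow> v \<in> span_upto S k"
  using le_degree le_less_trans by (fastforce simp: span_upto_def)

lemma span_upto_Suc:
  "span_upto S (Suc k) = (if k \<in> S then span_upto S k else {v. v - monom (coeff v k) k \<in> span_upto S k})"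
  by (auto simp: span_upto_def less_Suc_eq)

lemma valuation_extension:
  fixes \<nu>\<^sub>0 :: "rat poly \<Rightarrow> 'l::{distrib_lattice, bounded_lattice_bot}" and z :: "nat \<Rightarrow> 'l"
  assumes cn: "completely_normal TYPE('l)" and count: "countable (UNIV :: 'l set)"
    and val: "valuation_on (span_upto S 0) \<nu>\<^sub>0" and closed: "closed_on (span_upto S 0) \<nu>\<^sub>0"
  obtains \<nu> where "valuation_on UNIV \<nu>" "closed_on UNIV \<nu>" "\<And>v. v \<in> span_upto S 0 \<Longrightarrow> \<nu> v = \<nu>\<^sub>0 v"
    "\<And>k. k \<notin> S \<Longrightarrow> \<nu> (monom 1 k) = z k"
proof -
  let ?E = "span_upto S"
  define stage where "stage k \<nu> \<longleftrightarrow> valuation_on (?E k) \<nu> \<and> closed_on (?E k) \<nu> \<and> (k = 0 \<longrightarrow> \<nu> = \<nu>\<^sub>0)" for k \<nu>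
  define next_stage where "next_stage k \<nu> \<nu>' \<longleftrightarrow> (\<forall>v\<in>?E k. \<nu>' v = \<nu> v) \<and> (k \<notin> S \<longrightarrow> \<nu>' (monom 1 k) = z k)"
    for k \<nu> \<nu>'
  have "\<exists>\<nu>'. stage (Suc k) \<nu>' \<and> next_stage k \<nu> \<nu>'" if st: "stage k \<nu>" for k \<nu>
  proof (cases "k \<in> S")
    case True
    then show ?thesis using st by (auto simp: stage_def next_stage_def span_upto_Suc)
  next
    case False
    have "coeff v k = 0" if "v \<in> ?E k" for v using that False by (auto simp: span_upto_def)
    then show ?thesis
      using adjoin_monom[OF cn count subspace_span_upto, of S k \<nu> k "z k"] st False
      by (auto simp: stage_def next_stage_def span_upto_Suc)
  qed
  moreover have "stage 0 \<nu>\<^sub>0" using val closed by (simp add: stage_def)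
  ultimately obtain N where N: "\<And>k. stage k (N k)" "\<And>k. next_stage k (N k) (N (Suc k))"
    using dependent_nat_choice[of stage next_stage] by metis
  have agree: "\<forall>v\<in>?E k. N m v = N k v" if "k \<le> m" for k m
    using that
  proof (induction rule: dec_induct)
    case (step m)
    then show ?case
      using N(2)[of m] span_upto_mono[of k m S] unfolding next_stage_def by (metis subsetD)
  qed simp
  \<comment> \<open>Whatever \<open>S\<close> is, \<open>v\<close> belongs to stage
    \<open>Suc (degree v)\<close>, and later stages agree with it.\<close>
  define \<nu> where "\<nu> v = N (Suc (degree v)) v" for v
  have \<nu>: "\<nu> v = N k v" if "v \<in> ?E k" for v k
    using agree[of k "Suc (degree v)"] agree[of "Suc (degree v)" k] that mem_span_upto[of v "Suc (degree v)" S]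
    unfolding \<nu>_def by (metis lessI nle_le)
  have ex: "\<exists>k. u \<in> ?E k \<and> v \<in> ?E k" for u v
    using mem_span_upto[of u "Suc (max (degree u) (degree v))" S]
      mem_span_upto[of v "Suc (max (degree u) (degree v))" S]
    by (metis less_Suc_eq_le max.cobounded1 max.cobounded2)
  note sub = subspace_rules[OF subspace_span_upto]
  have "positive UNIV (P \<circ> \<nu>)" if P: "point P" for P
  proof
    have pos: "positive (?E k) (P \<circ> N k)" for k
      using N(1)[of k] P by (simp add: stage_def valuation_on_def)
    show "subspace UNIV" by (simp add: subspace_def)
    fix u v
    obtain k where k: "u \<in> ?E k" "v \<in> ?E k" using ex by blast
    interpret positive "?E k" "P \<circ> N k" by (rule pos)
    show "(P \<circ> \<nu>) v \<Longrightarrow> \<not> (P \<circ> \<nu>) (- v)"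
      using pos_asym[OF k(2)] \<nu>[OF k(2)] \<nu>[OF sub(4)[OF k(2)]] by simp
    show "(P \<circ> \<nu>) (u + v) \<Longrightarrow> (P \<circ> \<nu>) u \<or> (P \<circ> \<nu>) v"
      using pos_addD[OF k] \<nu>[OF k(1)] \<nu>[OF k(2)] \<nu>[OF sub(2)[OF k]] by simp
  qed
  then have "valuation_on UNIV \<nu>" by (simp add: valuation_on_def)
  moreover have "closed_on UNIV \<nu>"
    unfolding closed_on_def
  proof (intro ballI allI impI)
    fix f g x assume le: "\<nu> f \<le> \<nu> g \<curlyvee> x"
    obtain k where k: "f \<in> ?E k" "g \<in> ?E k" using ex by blast
    then have "N k f \<le> N k g \<curlyvee> x" using le \<nu> by simp
    then obtain n :: nat where "N k (f - smult (of_nat n) g) \<le> x \<curlyvee> N k (- g)"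
      using N(1)[of k] k unfolding stage_def closed_on_def by blast
    then show "\<exists>n::nat. \<nu> (f - smult (of_nat n) g) \<le> x \<curlyvee> \<nu> (- g)"
      using \<nu>[OF sub(5)[OF k(1) sub(3)[OF k(2)]]] \<nu>[OF sub(4)[OF k(2)]] by metis
  qed
  moreover have "\<nu> v = \<nu>\<^sub>0 v" if "v \<in> ?E 0" for v
    using \<nu>[OF that] N(1)[of 0] by (simp add: stage_def)
  moreover have "\<nu> (monom 1 k) = z k" if "k \<notin> S" for k
  proof -
    have "monom 1 k \<in> ?E (Suc k)" by (auto simp: span_upto_def)
    then show ?thesis using \<nu> N(2)[of k] that by (simp add: next_stage_def)
  qed
  ultimately show ?thesis using that by blast
qed

section \<open>Lattice-ordered groups from preordered groups\<close>

lemma lattice_gorderI: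
  assumes refl: "\<And>x. x \<in> C \<Longrightarrow> leq x x"
    and antisym: "\<And>x y. x \<in> C \<Longrightarrow> y \<in> C \<Longrightarrow> leq x y \<Longrightarrow> leq y x \<Longrightarrow> x = y"
    and trans: "\<And>x y z. x \<in> C \<Longrightarrow> y \<in> C \<Longrightarrow> z \<in> C \<Longrightarrow> leq x y \<Longrightarrow> leq y z \<Longrightarrow> leq x z"
    and lub: "\<And>x y. x \<in> C \<Longrightarrow> y \<in> C \<Longrightarrow>
      \<exists>s\<in>C. leq x s \<and> leq y s \<and> (\<forall>z\<in>C. leq x z \<longrightarrow> leq y z \<longrightarrow> leq s z)"
    and glb: "\<And>x y. x \<in> C \<Longrightarrow> y \<in> C \<Longrightarrow>
      \<exists>s\<in>C. leq s x \<and> leq s y \<and> (\<forall>z\<in>C. leq z x \<longrightarrow> leq z y \<longrightarrow> leq z s)"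
  shows "lattice \<lparr>carrier = C, eq = (=), le = leq\<rparr>"
proof unfold_locales
  fix x y assume "x \<in> carrier \<lparr>carrier = C, eq = (=), le = leq\<rparr>"
    "y \<in> carrier \<lparr>carrier = C, eq = (=), le = leq\<rparr>"
  then have xy: "x \<in> C" "y \<in> C" by auto
  show "\<exists>s. least \<lparr>carrier = C, eq = (=), le = leq\<rparr> s (Upper \<lparr>carrier = C, eq = (=), le = leq\<rparr> {x, y})"
  proof -
    obtain s where "s \<in> C" "leq x s" "leq y s" "\<forall>z\<in>C. leq x z \<longrightarrow> leq y z \<longrightarrow> leq s z"
      using lub[OF xy] by blast
    then show ?thesis using xy unfolding least_def Upper_def by (intro exI[of _ s]) auto
  qed
  show "\<exists>s. greatest \<lparr>carrier = C, eq = (=), le = leq\<rparr> s (Lower \<lparr>carrier = C, eq = (=), le = leq\<rparr> {x, y})"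
  proof -
    obtain s where "s \<in> C" "leq s x" "leq s y" "\<forall>z\<in>C. leq z x \<longrightarrow> leq z y \<longrightarrow> leq z s"
      using glb[OF xy] by blast
    then show ?thesis using xy unfolding greatest_def Lower_def by (intro exI[of _ s]) auto
  qed
qed (simp_all add: refl, (rule antisym trans; assumption)+)

lemma (in lattice) join_eqI:
  assumes "x \<in> carrier L" "y \<in> carrier L" "s \<in> carrier L" "x \<sqsubseteq> s" "y \<sqsubseteq> s"
    and "\<And>z. z \<in> carrier L \<Longrightarrow> x \<sqsubseteq> z \<Longrightarrow> y \<sqsubseteq> z \<Longrightarrow> s \<sqsubseteq> z"
  shows "x \<squnion> y = s"
proof (rule le_antisym)
  show "x \<squnion> y \<sqsubseteq> s" using assms by (intro join_le)
  show "s \<sqsubseteq> x \<squnion> y" by (rule assms(6)[OF join_closed join_left join_right]) fact+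
qed (use assms in auto)

lemma (in lattice) meet_eqI:
  assumes "x \<in> carrier L" "y \<in> carrier L" "s \<in> carrier L" "s \<sqsubseteq> x" "s \<sqsubseteq> y"
    and "\<And>z. z \<in> carrier L \<Longrightarrow> z \<sqsubseteq> x \<Longrightarrow> z \<sqsubseteq> y \<Longrightarrow> z \<sqsubseteq> s"
  shows "x \<sqinter> y = s"
proof (rule le_antisym)
  show "s \<sqsubseteq> x \<sqinter> y" using assms by (intro meet_le)
  show "x \<sqinter> y \<sqsubseteq> s" by (rule assms(6)[OF meet_closed meet_left meet_right]) fact+
qed (use assms in auto)

lemma lattice_type_order: "lattice (type_order :: 'a::{distrib_lattice, bounded_lattice_bot} gorder)"
  unfolding type_order_def
proof (rule lattice_gorderI)
  fix x y :: 'a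
  show "\<exists>s\<in>UNIV. x \<le> s \<and> y \<le> s \<and> (\<forall>z\<in>UNIV. x \<le> z \<longrightarrow> y \<le> z \<longrightarrow> s \<le> z)"
    by (intro bexI[of _ "x \<curlyvee> y"]) auto
  show "\<exists>s\<in>UNIV. s \<le> x \<and> s \<le> y \<and> (\<forall>z\<in>UNIV. z \<le> x \<longrightarrow> z \<le> y \<longrightarrow> z \<le> s)"
    by (intro bexI[of _ "x \<curlywedge> y"]) auto
qed auto

text \<open>A bijection that preserves and reflects the order onto a lattice transports suprema and
  infima back, so the source is a lattice as well.\<close>

lemma lattice_iso_type_orderI:
  fixes \<alpha> :: "'a \<Rightarrow> 'b::{distrib_lattice, bounded_lattice_bot}"
  assumes bij: "bij_betw \<alpha> C UNIV"
    and leq: "\<And>x y. x \<in> C \<Longrightarrow> y \<in> C \<Longrightarrow> leq x y \<longleftrightarrow> \<alpha> x \<le> \<alpha> y"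
  shows "lattice_iso \<lparr>carrier = C, eq = (=), le = leq\<rparr> type_order \<alpha>"
proof -
  have inj: "x = y" if "x \<in> C" "y \<in> C" "\<alpha> x = \<alpha> y" for x y
    using bij that by (auto simp: bij_betw_def inj_on_def)
  have surj: "\<exists>x\<in>C. \<alpha> x = z" for z
    using bij by (auto simp: bij_betw_def image_iff) (metis UNIV_I imageE)
  interpret X: lattice "\<lparr>carrier = C, eq = (=), le = leq\<rparr>"
  proof (rule lattice_gorderI)
    fix x y assume xy: "x \<in> C" "y \<in> C"
    obtain s where "s \<in> C" "\<alpha> s = \<alpha> x \<curlyvee> \<alpha> y" using surj by blast
    then show "\<exists>s\<in>C. leq x s \<and> leq y s \<and> (\<forall>z\<in>C. leq x z \<longrightarrow> leq y z \<longrightarrow> leq s z)"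
      using xy leq by (intro bexI[of _ s]) auto
    obtain i where "i \<in> C" "\<alpha> i = \<alpha> x \<curlywedge> \<alpha> y" using surj by blast
    then show "\<exists>s\<in>C. leq s x \<and> leq s y \<and> (\<forall>z\<in>C. leq z x \<longrightarrow> leq z y \<longrightarrow> leq z s)"
      using xy leq by (intro bexI[of _ i]) auto
  qed (use leq inj in \<open>auto intro: antisym\<close>)
  interpret Y: lattice "type_order :: 'b gorder" by (rule lattice_type_order)
  have Yjoin: "x \<squnion>\<^bsub>type_order\<^esub> y = x \<curlyvee> y" for x y :: 'b
    by (rule Y.join_eqI) (auto simp: type_order_def)
  have Ymeet: "x \<sqinter>\<^bsub>type_order\<^esub> y = x \<curlywedge> y" for x y :: 'b
    by (rule Y.meet_eqI) (auto simp: type_order_def)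
  have "\<alpha> (x \<squnion>\<^bsub>\<lparr>carrier = C, eq = (=), le = leq\<rparr>\<^esub> y) = \<alpha> x \<curlyvee> \<alpha> y"
    if xy: "x \<in> C" "y \<in> C" for x y
  proof -
    obtain s where s: "s \<in> C" "\<alpha> s = \<alpha> x \<curlyvee> \<alpha> y" using surj by blast
    then have "x \<squnion>\<^bsub>\<lparr>carrier = C, eq = (=), le = leq\<rparr>\<^esub> y = s"
      using xy leq by (intro X.join_eqI) auto
    then show ?thesis using s by simp
  qed
  moreover have "\<alpha> (x \<sqinter>\<^bsub>\<lparr>carrier = C, eq = (=), le = leq\<rparr>\<^esub> y) = \<alpha> x \<curlywedge> \<alpha> y"
    if xy: "x \<in> C" "y \<in> C" for x y
  proof -
    obtain s where s: "s \<in> C" "\<alpha> s = \<alpha> x \<curlywedge> \<alpha> y" using surj by blast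
    then have "x \<sqinter>\<^bsub>\<lparr>carrier = C, eq = (=), le = leq\<rparr>\<^esub> y = s"
      using xy leq by (intro X.meet_eqI) auto
    then show ?thesis using s by simp
  qed
  ultimately show ?thesis
    using bij X.lattice_axioms Y.lattice_axioms
    by (auto simp: lattice_iso_def join_pres_def meet_pres_def Yjoin Ymeet) (simp add: type_order_def)
qed

section \<open>The lattice-ordered group of a preordered group, coded in the natural numbers\<close>

abbreviation nmul :: "nat \<Rightarrow> 'a::monoid_add \<Rightarrow> 'a" where
  "nmul n x \<equiv> ((+) x ^^ n) 0"

text \<open>Functions on points are only preordered, and the group sought consists of the classes of
  mutually comparable elements. Countably many classes can be numbered, which gives a carrier inside
  \<open>nat\<close>. Joins suffice, as \<open>- jn (- x) (- y)\<close> is a meet.\<close>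

locale preordered_lgroup =
  fixes M :: "'m::ab_group_add set" and leq :: "'m \<Rightarrow> 'm \<Rightarrow> bool" and jn :: "'m \<Rightarrow> 'm \<Rightarrow> 'm"
  assumes zero_M [simp]: "0 \<in> M"
    and add_M [simp]: "x \<in> M \<Longrightarrow> y \<in> M \<Longrightarrow> x + y \<in> M"
    and uminus_M [simp]: "x \<in> M \<Longrightarrow> - x \<in> M"
    and jn_M [simp]: "x \<in> M \<Longrightarrow> y \<in> M \<Longrightarrow> jn x y \<in> M"
    and le_refl [simp]: "x \<in> M \<Longrightarrow> leq x x"
    and le_trans: "x \<in> M \<Longrightarrow> y \<in> M \<Longrightarrow> z \<in> M \<Longrightarrow> leq x y \<Longrightarrow> leq y z \<Longrightarrow> leq x z"
    and le_add: "x \<in> M \<Longrightarrow> y \<in> M \<Longrightarrow> z \<in> M \<Longrightarrow> leq x y \<Longrightarrow> leq (z + x) (z + y)"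
    and jn_ge1: "x \<in> M \<Longrightarrow> y \<in> M \<Longrightarrow> leq x (jn x y)"
    and jn_ge2: "x \<in> M \<Longrightarrow> y \<in> M \<Longrightarrow> leq y (jn x y)"
    and jn_least: "x \<in> M \<Longrightarrow> y \<in> M \<Longrightarrow> z \<in> M \<Longrightarrow> leq x z \<Longrightarrow> leq y z \<Longrightarrow> leq (jn x y) z"
    and countable_classes: "countable ((\<lambda>x. {y \<in> M. leq x y \<and> leq y x}) ` M)"
begin

definition cls :: "'m \<Rightarrow> 'm set" where
  "cls x = {y \<in> M. leq x y \<and> leq y x}"

definition code :: "'m \<Rightarrow> nat" where
  "code x = to_nat_on (cls ` M) (cls x)"

definition rep :: "nat \<Rightarrow> 'm" where
  "rep m = (SOME x. x \<in> M \<and> code x = m)"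

definition lgrp :: "nat lgroup" where
  "lgrp = \<lparr>carrier = code ` M, monoid.mult = (\<lambda>m n. code (rep m + rep n)), one = code 0,
    lgle = (\<lambda>m n. leq (rep m) (rep n))\<rparr>"

lemma code_eq_iff:
  assumes "x \<in> M" "y \<in> M" shows "code x = code y \<longleftrightarrow> leq x y \<and> leq y x"
proof -
  have "countable (cls ` M)" using countable_classes by (simp add: cls_def[abs_def])
  then have "code x = code y \<longleftrightarrow> cls x = cls y" using assms by (simp add: code_def)
  also have "\<dots> \<longleftrightarrow> leq x y \<and> leq y x"
    using assms le_refl le_trans unfolding cls_def by blast
  finally show ?thesis .
qed

lemma rep:
  assumes "m \<in> code ` M" shows "rep m \<in> M" "code (rep m) = m"
proof -
  have "rep m \<in> M \<and> code (rep m) = m"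
    unfolding rep_def by (rule someI_ex) (use assms in blast)
  then show "rep m \<in> M" "code (rep m) = m" by auto
qed

lemma rep_code: "x \<in> M \<Longrightarrow> leq x (rep (code x))" "x \<in> M \<Longrightarrow> leq (rep (code x)) x"
  using code_eq_iff[of x "rep (code x)"] rep[of "code x"] by auto

lemma carrier_lgrp: "carrier lgrp = code ` M"
  and one_lgrp: "\<one>\<^bsub>lgrp\<^esub> = code 0"
  by (simp_all add: lgrp_def)

lemma code_lgle:
  assumes x: "x \<in> M" and y: "y \<in> M"
  shows "lgle lgrp (code x) (code y) \<longleftrightarrow> leq x y"
proof -
  have r: "rep (code x) \<in> M" "rep (code y) \<in> M" using rep x y by blast+
  have "leq (rep (code x)) (rep (code y)) \<longleftrightarrow> leq x y"
    using le_trans[OF x r(1) y rep_code(1)[OF x]] le_trans[OF r(1) r(2) y _ rep_code(2)[OF y]]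
      le_trans[OF r(1) x y rep_code(2)[OF x]] le_trans[OF r(1) y r(2) _ rep_code(1)[OF y]] by blast
  then show ?thesis by (simp add: lgrp_def)
qed

lemma le_add_mono:
  assumes "x \<in> M" "y \<in> M" "u \<in> M" "v \<in> M" "leq x y" "leq u v" shows "leq (x + u) (y + v)"
  using le_add[of u v x] le_add[of x y v] le_trans[of "x + u" "x + v" "y + v"] assms
  by (simp add: add.commute)

lemma code_mult: "x \<in> M \<Longrightarrow> y \<in> M \<Longrightarrow> code x \<otimes>\<^bsub>lgrp\<^esub> code y = code (x + y)"
  using rep_code rep(1) le_add_mono by (simp add: lgrp_def code_eq_iff)

lemma le_uminus: assumes "x \<in> M" "y \<in> M" "leq x y" shows "leq (- y) (- x)"
  using le_add[of x y "- x - y"] assms add_M[of "- x" "- y"] by (simp add: add.commute)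

lemma lattice_lorder: "lattice (lorder lgrp)"
  unfolding lorder_def
proof (rule lattice_gorderI)
  fix m n assume "m \<in> carrier lgrp" "n \<in> carrier lgrp"
  then obtain x y where xy: "x \<in> M" "y \<in> M" "m = code x" "n = code y" by (auto simp: carrier_lgrp)
  show "lgle lgrp m m" "lgle lgrp m n \<Longrightarrow> lgle lgrp n m \<Longrightarrow> m = n"
    using xy by (auto simp: code_lgle code_eq_iff)
  show "\<exists>s\<in>carrier lgrp. lgle lgrp m s \<and> lgle lgrp n s \<and>
      (\<forall>z\<in>carrier lgrp. lgle lgrp m z \<longrightarrow> lgle lgrp n z \<longrightarrow> lgle lgrp s z)"
    using xy jn_ge1 jn_ge2 jn_least
    by (intro bexI[of _ "code (jn x y)"]) (auto simp: carrier_lgrp code_lgle)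
  show "\<exists>s\<in>carrier lgrp. lgle lgrp s m \<and> lgle lgrp s n \<and>
      (\<forall>z\<in>carrier lgrp. lgle lgrp z m \<longrightarrow> lgle lgrp z n \<longrightarrow> lgle lgrp z s)"
  proof (intro bexI[of _ "code (- jn (- x) (- y))"] conjI ballI impI)
    show "lgle lgrp (code (- jn (- x) (- y))) m" "lgle lgrp (code (- jn (- x) (- y))) n"
      using xy jn_ge1[of "- x" "- y"] jn_ge2[of "- x" "- y"] le_uminus[of "- x"] le_uminus[of "- y"]
      by (auto simp: code_lgle)
    fix z assume "z \<in> carrier lgrp" and z: "lgle lgrp z m" "lgle lgrp z n"
    then obtain w where w: "w \<in> M" "z = code w" by (auto simp: carrier_lgrp)
    then have "leq (jn (- x) (- y)) (- w)"
      using z xy by (intro jn_least) (auto simp: code_lgle intro: le_uminus)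
    then show "lgle lgrp z (code (- jn (- x) (- y)))"
      using w xy le_uminus[of "jn (- x) (- y)" "- w"] by (simp add: code_lgle)
  qed (use xy in \<open>auto simp: carrier_lgrp\<close>)
  fix k assume "k \<in> carrier lgrp" "lgle lgrp m n" "lgle lgrp n k"
  then show "lgle lgrp m k"
    using xy by (auto simp: carrier_lgrp code_lgle intro: le_trans)
qed

sublocale lg: abelian_lgroup lgrp
proof -
  have "comm_group lgrp"
  proof (rule comm_groupI)
    fix m assume "m \<in> carrier lgrp"
    then obtain x where x: "x \<in> M" "m = code x" by (auto simp: carrier_lgrp)
    then have "code (- x) \<otimes>\<^bsub>lgrp\<^esub> m = \<one>\<^bsub>lgrp\<^esub>" by (simp add: code_mult one_lgrp)
    then show "\<exists>y\<in>carrier lgrp. y \<otimes>\<^bsub>lgrp\<^esub> m = \<one>\<^bsub>lgrp\<^esub>"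
      using x by (intro bexI[of _ "code (- x)"]) (auto simp: carrier_lgrp)
  qed (auto simp: carrier_lgrp code_mult one_lgrp add_ac)
  then show "abelian_lgroup lgrp"
    by (intro abelian_lgroup.intro abelian_lgroup_axioms.intro lattice_lorder)
      (auto simp: carrier_lgrp code_mult code_lgle intro: le_add)
qed

lemma code_inv: "x \<in> M \<Longrightarrow> inv\<^bsub>lgrp\<^esub> (code x) = code (- x)"
  by (intro lg.inv_equality) (auto simp: code_mult one_lgrp carrier_lgrp)

lemma code_join: "x \<in> M \<Longrightarrow> y \<in> M \<Longrightarrow> code x \<squnion>\<^bsub>lorder lgrp\<^esub> code y = code (jn x y)"
  by (intro lg.ord.join_eqI) (auto simp: lorder_def carrier_lgrp code_lgle jn_ge1 jn_ge2 jn_least)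

lemma meet_le:
  assumes "x \<in> M" "y \<in> M"
  shows "leq (- jn (- x) (- y)) x" "leq (- jn (- x) (- y)) y"
  using jn_ge1[of "- x" "- y"] jn_ge2[of "- x" "- y"] le_uminus[of "- x"] le_uminus[of "- y"] assms by auto

lemma meet_greatest:
  assumes "x \<in> M" "y \<in> M" "z \<in> M" "leq z x" "leq z y"
  shows "leq z (- jn (- x) (- y))"
  using jn_least[of "- x" "- y" "- z"] le_uminus[of "jn (- x) (- y)" "- z"] assms
  by (simp add: le_uminus)

lemma code_meet: "x \<in> M \<Longrightarrow> y \<in> M \<Longrightarrow>
    code x \<sqinter>\<^bsub>lorder lgrp\<^esub> code y = code (- jn (- x) (- y))"
  by (intro lg.ord.meet_eqI) (auto simp: lorder_def carrier_lgrp code_lgle meet_le meet_greatest)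

lemma nmul_M [simp]: "x \<in> M \<Longrightarrow> nmul n x \<in> M"
  by (induction n) auto

lemma code_pow: "x \<in> M \<Longrightarrow> code x [^]\<^bsub>lgrp\<^esub> n = code (nmul n x)" for n :: nat
  by (induction n) (auto simp: one_lgrp code_mult add.commute)

lemma code_labs_pos: "x \<in> M \<Longrightarrow> leq 0 x \<Longrightarrow> labs lgrp (code x) = code x"
proof -
  assume x: "x \<in> M" "leq 0 x"
  then have "leq (- x) x" using le_uminus[of 0 x] le_trans[of "- x" 0 x] by simp
  then show ?thesis
    using x by (simp add: labs_def code_inv code_join code_eq_iff jn_ge1 jn_least)
qed

lemma pos_cone_lgrp: "pos_cone lgrp = code ` {x \<in> M. leq 0 x}"
  by (auto simp: pos_cone_def carrier_lgrp one_lgrp code_lgle)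

lemma principal_subset_iff:
  assumes "x \<in> M" "y \<in> M" "leq 0 x" "leq 0 y"
  shows "principal_lideal lgrp (code x) \<subseteq> principal_lideal lgrp (code y) \<longleftrightarrow> (\<exists>n. leq x (nmul n y))"
proof
  assume "principal_lideal lgrp (code x) \<subseteq> principal_lideal lgrp (code y)"
  then have "code x \<in> principal_lideal lgrp (code y)"
    using lg.principal_lideal_self[of "code x"] assms by (auto simp: carrier_lgrp)
  then show "\<exists>n. leq x (nmul n y)"
    using assms by (auto simp: principal_lideal_def code_labs_pos code_pow code_lgle)
next
  assume "\<exists>n. leq x (nmul n y)"
  then show "principal_lideal lgrp (code x) \<subseteq> principal_lideal lgrp (code y)"
    using assms lg.principal_lideal_mono[of "code x" "code y"]
    by (auto simp: code_labs_pos code_pow code_lgle carrier_lgrp)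
qed

end

section \<open>The lattice-ordered group of a closed valuation\<close>

text \<open>
  A point \<open>P\<close> preorders \<open>rat poly\<close> totally. The group consists of the maps that send each point to
  a vector and admit a finite cover of the space of points by sets \<open>{P. \<not> P w}\<close> on which they
  are equivalent to a constant. Such sets are closed for the Zariski topology; this is what makes
  closedness of the valuation applicable.
\<close>

locale closed_valuation =
  fixes \<nu> :: "rat poly \<Rightarrow> 'l::{distrib_lattice, bounded_lattice_bot}"
  assumes countable_lattice: "countable (UNIV :: 'l set)"
    and valuation: "valuation_on UNIV \<nu>"
    and closed: "closed_on UNIV \<nu>"
    and surj: "surj \<nu>"
begin

definition leq :: "(('l \<Rightarrow> bool) \<Rightarrow> rat poly) \<Rightarrow> (('l \<Rightarrow> bool) \<Rightarrow> rat poly) \<Rightarrow> bool" where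
  "leq s t \<longleftrightarrow> (\<forall>P. point P \<longrightarrow> \<not> P (\<nu> (s P - t P)))"

definition jn :: "(('l \<Rightarrow> bool) \<Rightarrow> rat poly) \<Rightarrow> (('l \<Rightarrow> bool) \<Rightarrow> rat poly) \<Rightarrow> ('l \<Rightarrow> bool) \<Rightarrow> rat poly"
  where "jn s t = (\<lambda>P. if P (\<nu> (s P - t P)) then s P else t P)"

definition presents :: "(rat poly \<times> 'l) set \<Rightarrow> (('l \<Rightarrow> bool) \<Rightarrow> rat poly) \<Rightarrow> bool" where
  "presents D s \<longleftrightarrow> finite D \<and> (\<forall>P. point P \<longrightarrow> (\<exists>(f, w)\<in>D. \<not> P w) \<and>
    (\<forall>(f, w)\<in>D. \<not> P w \<longrightarrow> \<not> P (\<nu> (s P - f)) \<and> \<not> P (\<nu> (f - s P))))"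

definition sections :: "(('l \<Rightarrow> bool) \<Rightarrow> rat poly) set" where
  "sections = {s. \<exists>D. presents D s}"

lemma positive_point: "point P \<Longrightarrow> positive UNIV (P \<circ> \<nu>)"
  using valuation by (simp add: valuation_on_def)

lemma point_zero [simp]: "point P \<Longrightarrow> \<not> P (\<nu> 0)"
  using positive.not_pos_0[OF positive_point] by simp

lemma point_asym: "point P \<Longrightarrow> P (\<nu> (u - v)) \<Longrightarrow> \<not> P (\<nu> (v - u))"
  using positive.pos_asym[OF positive_point, of P "u - v"] by simp

lemma point_trans: "point P \<Longrightarrow> \<not> P (\<nu> (u - v)) \<Longrightarrow> \<not> P (\<nu> (v - w)) \<Longrightarrow> \<not> P (\<nu> (u - w))"
  using positive.pos_addD[OF positive_point, of P "u - v" "v - w"] by auto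

lemma point_add:
  assumes "point P" "\<not> P (\<nu> (u - v))" "\<not> P (\<nu> (u' - v'))" shows "\<not> P (\<nu> (u + u' - (v + v')))"
  using positive.pos_addD[OF positive_point, of P "u - v" "u' - v'"] assms
  by (auto simp: algebra_simps)

lemma leq_transitive:
  assumes "leq s t" "leq t u" shows "leq s u"
  unfolding leq_def
proof (intro allI impI)
  fix P :: "'l \<Rightarrow> bool" assume P: "point P"
  show "\<not> P (\<nu> (s P - u P))"
    using point_trans[OF P, of "s P" "t P" "u P"] assms P unfolding leq_def by blast
qed

lemma presents_finite: "presents D s \<Longrightarrow> finite D"
  and presents_cover: "presents D s \<Longrightarrow> point P \<Longrightarrow> \<exists>f w. (f, w) \<in> D \<and> \<not> P w"
  and presents_at: "presents D s \<Longrightarrow> point P \<Longrightarrow> (f, w) \<in> D \<Longrightarrow> \<not> P w \<Longrightarrow>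
    \<not> P (\<nu> (s P - f)) \<and> \<not> P (\<nu> (f - s P))"
  unfolding presents_def by blast+

lemma presentsI:
  assumes "finite D" "\<And>P. point P \<Longrightarrow> \<exists>f w. (f, w) \<in> D \<and> \<not> P w"
    and "\<And>P f w. point P \<Longrightarrow> (f, w) \<in> D \<Longrightarrow> \<not> P w \<Longrightarrow> \<not> P (\<nu> (s P - f)) \<and> \<not> P (\<nu> (f - s P))"
  shows "presents D s"
  using assms unfolding presents_def by blast

text \<open>A presentation fixes a section up to equivalence, so there are no more classes than
  finite sets of pairs; this is the source of countability.\<close>

lemma presents_unique: "presents D s \<Longrightarrow> presents D t \<Longrightarrow> leq s t"
  unfolding leq_def
proof (intro allI impI)
  fix P :: "'l \<Rightarrow> bool" assume s: "presents D s" and t: "presents D t" and P: "point P"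
  obtain f w where "(f, w) \<in> D" "\<not> P w" using presents_cover[OF s P] by blast
  then show "\<not> P (\<nu> (s P - t P))"
    using presents_at[OF s P] presents_at[OF t P] point_trans[OF P] by blast
qed

lemma const_section: "(\<lambda>_. v) \<in> sections"
proof -
  have "presents {(v, bot)} (\<lambda>_. v)" by (rule presentsI) auto
  then show ?thesis by (auto simp: sections_def)
qed

lemma add_section:
  assumes "s \<in> sections" "t \<in> sections" shows "s + t \<in> sections"
proof -
  obtain D D' where D: "presents D s" "presents D' t" using assms by (auto simp: sections_def)
  \<comment> \<open>Both \<open>w\<close> and \<open>u\<close> fail exactly where
    \<open>w \<curlyvee> u\<close> fails, so pieces intersect by joining their labels.\<close>
  let ?h = "\<lambda>((f, w), (g, u)). (f + g, w \<curlyvee> u)"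
  let ?D = "?h ` (D \<times> D')"
  have "presents ?D (s + t)"
  proof (rule presentsI)
    show "finite ?D" using D presents_finite by blast
    fix P :: "'l \<Rightarrow> bool" assume P: "point P"
    obtain f w where f: "(f, w) \<in> D" "\<not> P w" using presents_cover[OF D(1) P] by blast
    obtain g u where g: "(g, u) \<in> D'" "\<not> P u" using presents_cover[OF D(2) P] by blast
    have "?h ((f, w), (g, u)) \<in> ?D" using f g by (intro imageI) blast
    then show "\<exists>f w. (f, w) \<in> ?D \<and> \<not> P w"
      using P f g by (intro exI[of _ "f + g"] exI[of _ "w \<curlyvee> u"]) simp
  next
    fix P h v assume P: "point P" and "(h, v) \<in> ?D" and v: "\<not> P v"
    then obtain f w g u where fg: "(f, w) \<in> D" "(g, u) \<in> D'" "h = f + g" "v = w \<curlyvee> u" by auto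
    then show "\<not> P (\<nu> ((s + t) P - h)) \<and> \<not> P (\<nu> (h - (s + t) P))"
      using presents_at[OF D(1) P fg(1)] presents_at[OF D(2) P fg(2)] v P
        point_add[OF P, of "s P" f "t P" g] point_add[OF P, of f "s P" g "t P"] by simp
  qed
  then show ?thesis by (auto simp: sections_def)
qed

lemma uminus_section:
  assumes "s \<in> sections" shows "- s \<in> sections"
proof -
  obtain D where D: "presents D s" using assms by (auto simp: sections_def)
  let ?h = "\<lambda>(f, w). (- f, w)"
  have "presents (?h ` D) (- s)"
  proof (rule presentsI)
    show "finite (?h ` D)" using D presents_finite by blast
    fix P :: "'l \<Rightarrow> bool" assume P: "point P"
    obtain f w where f: "(f, w) \<in> D" "\<not> P w" using presents_cover[OF D(1) P] by blast
    have "?h (f, w) \<in> ?h ` D" using f by (intro imageI) blast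
    then show "\<exists>f w. (f, w) \<in> ?h ` D \<and> \<not> P w"
      using f by (intro exI[of _ "- f"] exI[of _ w]) simp
  next
    fix P h v assume P: "point P" and "(h, v) \<in> ?h ` D" and v: "\<not> P v"
    then obtain f where f: "(f, v) \<in> D" "h = - f" by auto
    then show "\<not> P (\<nu> ((- s) P - h)) \<and> \<not> P (\<nu> (h - (- s) P))"
      using presents_at[OF D P f(1) v] by simp
  qed
  then show ?thesis by (auto simp: sections_def)
qed

lemma jn_section:
  assumes "s \<in> sections" "t \<in> sections" shows "jn s t \<in> sections"
proof -
  obtain D D' where D: "presents D s" "presents D' t" using assms by (auto simp: sections_def)
  \<comment> \<open>Each intersection of pieces is split into the part where
    \<open>g \<le> f\<close> and the part where \<open>f \<le> g\<close>; by asymmetry the two parts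
    cover it.\<close>
  let ?h = "\<lambda>((f, w), (g, u)). (f, w \<curlyvee> u \<curlyvee> \<nu> (g - f))"
  let ?h' = "\<lambda>((f, w), (g, u)). (g, w \<curlyvee> u \<curlyvee> \<nu> (f - g))"
  let ?D = "?h ` (D \<times> D') \<union> ?h' ` (D \<times> D')"
  have "presents ?D (jn s t)"
  proof (rule presentsI)
    show "finite ?D" using D presents_finite by blast
    fix P :: "'l \<Rightarrow> bool" assume P: "point P"
    obtain f w where f: "(f, w) \<in> D" "\<not> P w" using presents_cover[OF D(1) P] by blast
    obtain g u where g: "(g, u) \<in> D'" "\<not> P u" using presents_cover[OF D(2) P] by blast
    have mem: "((f, w), (g, u)) \<in> D \<times> D'" using f g by blast
    show "\<exists>f w. (f, w) \<in> ?D \<and> \<not> P w"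
    proof (cases "P (\<nu> (g - f))")
      case True
      then have "\<not> P (w \<curlyvee> u \<curlyvee> \<nu> (f - g))" using f g P point_asym by simp
      moreover have "(g, w \<curlyvee> u \<curlyvee> \<nu> (f - g)) \<in> ?D" using imageI[OF mem, of ?h'] by simp
      ultimately show ?thesis by blast
    next
      case False
      then have "\<not> P (w \<curlyvee> u \<curlyvee> \<nu> (g - f))" using f g P by simp
      moreover have "(f, w \<curlyvee> u \<curlyvee> \<nu> (g - f)) \<in> ?D" using imageI[OF mem, of ?h] by simp
      ultimately show ?thesis by blast
    qed
  next
    fix P h v assume P: "point P" and h: "(h, v) \<in> ?D" and v: "\<not> P v"
    from h obtain f w g u where fg: "(f, w) \<in> D" "(g, u) \<in> D'"
      and hv: "h = f \<and> v = w \<curlyvee> u \<curlyvee> \<nu> (g - f) \<or> h = g \<and> v = w \<curlyvee> u \<curlyvee> \<nu> (f - g)" by auto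
    have wu: "\<not> P w" "\<not> P u" and fgh: "h = f \<and> \<not> P (\<nu> (g - f)) \<or> h = g \<and> \<not> P (\<nu> (f - g))"
      using hv v P by auto
    note e = presents_at[OF D(1) P fg(1) wu(1)] presents_at[OF D(2) P fg(2) wu(2)]
    have tr: "\<not> P (\<nu> (u - v)) \<Longrightarrow> \<not> P (\<nu> (v - w)) \<Longrightarrow> \<not> P (\<nu> (u - w))" for u v w
      using point_trans[OF P] .
    show "\<not> P (\<nu> (jn s t P - h)) \<and> \<not> P (\<nu> (h - jn s t P))"
    proof (cases "P (\<nu> (s P - t P))")
      case True
      then have j: "jn s t P = s P" and ts: "\<not> P (\<nu> (t P - s P))"
        using point_asym P by (auto simp: jn_def)
      have "\<not> P (\<nu> (g - s P))" "\<not> P (\<nu> (g - f))" using tr e ts by blast+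
      then show ?thesis unfolding j using e fgh tr[of "s P" f g] by auto
    next
      case False
      then have j: "jn s t P = t P" by (simp add: jn_def)
      have "\<not> P (\<nu> (f - t P))" "\<not> P (\<nu> (f - g))" using tr e False by blast+
      then show ?thesis unfolding j using e fgh tr[of "t P" g f] by auto
    qed
  qed
  then show ?thesis by (auto simp: sections_def)
qed

lemma countable_section_classes: "countable ((\<lambda>s. {t \<in> sections. leq s t \<and> leq t s}) ` sections)"
proof -
  let ?c = "\<lambda>s. {t \<in> sections. leq s t \<and> leq t s}"
  have "countable {D :: (rat poly \<times> 'l) set. finite D \<and> D \<subseteq> UNIV \<times> UNIV}"
    by (intro countable_Collect_finite_subset countable_SIGMA countable_rat_poly countable_lattice)
  then have "countable ((\<lambda>D. ?c (SOME s. presents D s)) ` {D. finite D \<and> D \<subseteq> UNIV \<times> UNIV})" (is "countable ?I")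
    by (rule countable_image)
  moreover have "?c ` sections \<subseteq> ?I"
  proof
    fix X assume "X \<in> ?c ` sections"
    then obtain s D where X: "X = ?c s" and D: "presents D s" by (auto simp: sections_def)
    define s' where "s' = (SOME s. presents D s)"
    have s': "presents D s'" using someI[of "presents D" s, OF D] by (simp add: s'_def)
    have eq: "leq s s'" "leq s' s" using presents_unique D s' by blast+
    have "X = ?c s'" unfolding X using eq leq_transitive by blast
    moreover have "finite D" using D by (simp add: presents_def)
    ultimately show "X \<in> ?I" unfolding s'_def by (intro image_eqI[of _ _ D]) auto
  qed
  ultimately show ?thesis by (rule countable_subset[rotated])
qed

sublocale preordered_lgroup sections leq jn
proof
  show "0 \<in> sections" using const_section[of 0] by (simp add: zero_fun_def)
next
  fix s t u assume "leq s t" "leq t u" then show "leq s u" by (rule leq_transitive)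
next
  fix s t z z' assume "leq s t"
  then show "leq (z + s) (z + t)" by (simp add: leq_def)
next
  fix s t
  show "leq s (jn s t)" "leq t (jn s t)"
    using point_asym by (auto simp: leq_def jn_def)
  fix u assume "leq s u" "leq t u" then show "leq (jn s t) u"
    by (auto simp: leq_def jn_def)
next
  fix s show "leq s s" by (simp add: leq_def)
qed (simp_all add: add_section uminus_section jn_section countable_section_classes)

section \<open>Supports and principal ideals\<close>

lemma nmul_apply: "nmul n s P = smult (of_nat n) (s P)" for s :: "('l \<Rightarrow> bool) \<Rightarrow> rat poly"
  by (induction n) (simp_all add: smult_add_left)

text \<open>The support is the meet of \<open>w \<curlyvee> \<nu> f\<close> over all pieces. At a
  point a piece with \<open>w\<close> failing contributes the sign of the section, and a piece with
  \<open>w\<close> holding contributes nothing.\<close>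

lemma supp_exists:
  assumes "s \<in> sections"
  shows "\<exists>z. \<forall>P. point P \<longrightarrow> P z = P (\<nu> (s P))"
proof -
  obtain D where D: "presents D s" using assms by (auto simp: sections_def)
  \<comment> \<open>The constantly false point has to be covered too.\<close>
  have "D \<noteq> {}" using presents_cover[OF D point_False] by blast
  then obtain z where z: "\<And>P. point P \<Longrightarrow> P z = (\<forall>d\<in>D. P (snd d \<curlyvee> \<nu> (fst d)))"
    using finite_meet_exists[OF presents_finite[OF D], of "\<lambda>d. snd d \<curlyvee> \<nu> (fst d)"] by blast
  have "P z = P (\<nu> (s P))" if P: "point P" for P
  proof -
    have eq: "P (\<nu> f) = P (\<nu> (s P))" if "(f, w) \<in> D" "\<not> P w" for f w
      using presents_at[OF D P that] point_trans[OF P, of f "s P" 0] point_trans[OF P, of "s P" f 0] by auto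
    obtain f w where f: "(f, w) \<in> D" "\<not> P w" using presents_cover[OF D P] by blast
    show ?thesis
    proof
      assume "P z"
      then have "P (w \<curlyvee> \<nu> f)" using z[OF P] f(1) by fastforce
      then show "P (\<nu> (s P))" using eq[OF f] f P by simp
    next
      assume "P (\<nu> (s P))"
      then have "P (snd d \<curlyvee> \<nu> (fst d))" if "d \<in> D" for d
        using that eq[of "fst d" "snd d"] P by auto
      then show "P z" using z[OF P] by blast
    qed
  qed
  then show ?thesis by blast
qed

definition supp :: "(('l \<Rightarrow> bool) \<Rightarrow> rat poly) \<Rightarrow> 'l" where
  "supp s = (SOME z. \<forall>P. point P \<longrightarrow> P z = P (\<nu> (s P)))"

lemma supp: "s \<in> sections \<Longrightarrow> point P \<Longrightarrow> P (supp s) = P (\<nu> (s P))"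
  using someI_ex[OF supp_exists[of s]] unfolding supp_def by blast

text \<open>Here closedness enters. On a common piece \<open>s\<close> is equivalent to
  \<open>f\<close> and \<open>t\<close> to \<open>g\<close>, so inclusion of supports reads
  \<open>\<nu> f \<le> \<nu> g \<curlyvee> (w \<curlyvee> u)\<close>, and closedness gives
  \<open>f \<le> m g\<close> there, the term \<open>\<nu> (- g)\<close> being void because
  \<open>t \<ge> 0\<close>. The estimate is the chain \<open>s\<close>, \<open>f\<close>,
  \<open>m g\<close>, \<open>n g\<close>, \<open>n t\<close>.\<close>

lemma supp_le_imp_bounded:
  assumes s: "s \<in> sections" and t: "t \<in> sections" and t0: "leq 0 t" and le: "supp s \<le> supp t"
  shows "\<exists>n. leq s (nmul n t)"
proof -
  obtain D D' where D: "presents D s" "presents D' t" using s t by (auto simp: sections_def)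
  have "\<exists>n::nat. \<nu> (f - smult (of_nat n) g) \<le> w \<curlyvee> u \<curlyvee> \<nu> (- g)"
    if fg: "(f, w) \<in> D" "(g, u) \<in> D'" for f w g u
  proof -
    have "\<nu> f \<le> \<nu> g \<curlyvee> (w \<curlyvee> u)"
      unfolding le_iff_points
    proof (intro allI impI, rule ccontr)
      fix P :: "'l \<Rightarrow> bool" assume P: "point P" and f: "P (\<nu> f)" and "\<not> P (\<nu> g \<curlyvee> (w \<curlyvee> u))"
      then have *: "\<not> P (\<nu> g)" "\<not> P w" "\<not> P u" by auto
      have "P (\<nu> (s P))"
        using presents_at[OF D(1) P fg(1) *(2)] point_trans[OF P, of f "s P" 0] f by auto
      then have "P (\<nu> (t P))" using point_mono[OF P le] supp s t P by blast
      then have "P (\<nu> g)"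
        using presents_at[OF D(2) P fg(2) *(3)] point_trans[OF P, of "t P" g 0] by auto
      then show False using * by blast
    qed
    then show ?thesis using closed unfolding closed_on_def by blast
  qed
  then have "\<forall>c d. \<exists>n::nat. c \<in> D \<longrightarrow> d \<in> D' \<longrightarrow>
      \<nu> (fst c - smult (of_nat n) (fst d)) \<le> snd c \<curlyvee> snd d \<curlyvee> \<nu> (- fst d)"
    by (metis prod.collapse)
  then obtain N :: "(rat poly \<times> 'l) \<Rightarrow> (rat poly \<times> 'l) \<Rightarrow> nat" where
    N': "\<And>c d. c \<in> D \<Longrightarrow> d \<in> D' \<Longrightarrow>
      \<nu> (fst c - smult (of_nat (N c d)) (fst d)) \<le> snd c \<curlyvee> snd d \<curlyvee> \<nu> (- fst d)"
    by metis
  have N: "\<nu> (f - smult (of_nat (N (f, w) (g, u))) g) \<le> w \<curlyvee> u \<curlyvee> \<nu> (- g)"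
    if "(f, w) \<in> D" "(g, u) \<in> D'" for f w g u
    using N'[OF that] by simp
  \<comment> \<open>Raising the multiple is harmless where \<open>g \<ge> 0\<close>, so the maximum
    over the finitely many pairs of pieces works everywhere.\<close>
  define n where "n = Max ((\<lambda>(c, d). N c d) ` (D \<times> D'))"
  have fin: "finite (D \<times> D')" using D presents_finite by blast
  have "leq s (nmul n t)"
    unfolding leq_def
  proof (intro allI impI)
    fix P :: "'l \<Rightarrow> bool" assume P: "point P"
    obtain f w where f: "(f, w) \<in> D" "\<not> P w" using presents_cover[OF D(1) P] by blast
    obtain g u where g: "(g, u) \<in> D'" "\<not> P u" using presents_cover[OF D(2) P] by blast
    interpret positive UNIV "P \<circ> \<nu>" by (rule positive_point[OF P])
    let ?m = "N (f, w) (g, u)"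
    have mn: "?m \<le> n" unfolding n_def using fin f g by (intro Max_ge) force+
    have tg: "\<not> P (\<nu> (g - t P))" "\<not> P (\<nu> (t P - g))" using presents_at[OF D(2) P g] by auto
    have t0P: "\<not> P (\<nu> (- t P))" using t0 P by (auto simp: leq_def)
    then have g0: "\<not> P (\<nu> (- g))" using point_trans[OF P, of 0 "t P" g] tg by simp
    have 1: "\<not> P (\<nu> (s P - f))" using presents_at[OF D(1) P f] by auto
    have 2: "\<not> P (\<nu> (f - smult (of_nat ?m) g))"
      using point_mono[OF P N[OF f(1) g(1)]] f g g0 P by auto
    have "\<not> P (\<nu> (smult (of_nat (n - ?m)) (- g)))"
      using not_pos_smult_nat[of "- g" "n - ?m"] g0 by simp
    moreover have "smult (of_nat (n - ?m)) (- g) = smult (of_nat ?m) g - smult (of_nat n) g"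
      using mn by (intro poly_eqI) (simp add: of_nat_diff algebra_simps)
    ultimately have 3: "\<not> P (\<nu> (smult (of_nat ?m) g - smult (of_nat n) g))" by simp
    have "\<not> P (\<nu> (smult (of_nat n) (g - t P)))"
      using not_pos_smult_nat[of "g - t P" n] tg by simp
    then have 4: "\<not> P (\<nu> (smult (of_nat n) g - smult (of_nat n) (t P)))"
      by (simp add: smult_diff_right)
    have "\<not> P (\<nu> (s P - smult (of_nat n) (t P)))"
      by (rule point_trans[OF P point_trans[OF P point_trans[OF P 1 2] 3] 4])
    then show "\<not> P (\<nu> (s P - nmul n t P))" unfolding nmul_apply .
  qed
  then show ?thesis by blast
qed

lemma bounded_imp_supp_le:
  assumes s: "s \<in> sections" and t: "t \<in> sections" and le: "leq s (nmul n t)"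
  shows "supp s \<le> supp t"
  unfolding le_iff_points
proof (intro allI impI)
  fix P :: "'l \<Rightarrow> bool" assume P: "point P" and "P (supp s)"
  then have sP: "P (\<nu> (s P))" using supp s by blast
  interpret positive UNIV "P \<circ> \<nu>" by (rule positive_point[OF P])
  have "\<not> P (\<nu> (s P - nmul n t P))" using le P unfolding leq_def by blast
  then have "\<not> P (\<nu> (s P - smult (of_nat n) (t P)))" unfolding nmul_apply .
  then have "P (\<nu> (smult (of_nat n) (t P)))"
    using sP point_trans[OF P, of "s P" "smult (of_nat n) (t P)" 0] by auto
  then have "P (\<nu> (t P))" using not_pos_smult_nat[of "t P" n] by auto
  then show "P (supp t)" using supp t P by blast
qed

lemma principal_subset_iff_supp:
  assumes "s \<in> sections" "t \<in> sections" "leq 0 s" "leq 0 t"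
  shows "principal_lideal lgrp (code s) \<subseteq> principal_lideal lgrp (code t) \<longleftrightarrow> supp s \<le> supp t"
  using principal_subset_iff[OF assms] supp_le_imp_bounded[OF assms(1,2,4)] bounded_imp_supp_le[OF assms(1,2)]
  by blast

definition ideal_supp :: "nat set \<Rightarrow> 'l" where
  "ideal_supp I = (SOME z. \<exists>s\<in>sections. leq 0 s \<and> I = principal_lideal lgrp (code s) \<and> z = supp s)"

lemma ideal_supp_principal:
  assumes "s \<in> sections" "leq 0 s"
  shows "ideal_supp (principal_lideal lgrp (code s)) = supp s"
proof -
  let ?I = "principal_lideal lgrp (code s)"
  have "\<exists>z. \<exists>t\<in>sections. leq 0 t \<and> ?I = principal_lideal lgrp (code t) \<and> z = supp t"
    using assms by blast
  from someI_ex[OF this] obtain t where t: "t \<in> sections" "leq 0 t" "?I = principal_lideal lgrp (code t)"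
    "ideal_supp ?I = supp t" unfolding ideal_supp_def by blast
  then show ?thesis
    using principal_subset_iff_supp[of s t] principal_subset_iff_supp[of t s] assms by (auto intro: antisym)
qed

lemma supp_surj: "\<exists>s\<in>sections. leq 0 s \<and> supp s = z"
proof -
  obtain v where v: "z = \<nu> v" using surj by blast
  \<comment> \<open>The positive part of the constant section \<open>v\<close> has the same support
    as \<open>v\<close>.\<close>
  let ?s = "jn (\<lambda>_. v) 0"
  have s: "?s \<in> sections" by (intro jn_section const_section zero_M)
  have "P (supp ?s) = P z" if P: "point P" for P
    using supp[OF s P] P by (auto simp: jn_def v)
  then have "supp ?s = z" by (rule eq_pointsI)
  moreover have "leq 0 ?s" by (intro jn_ge2 const_section zero_M)
  ultimately show ?thesis using s by blast
qed

lemma carrier_Idc: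
  "carrier (Idc lgrp) = (\<lambda>s. principal_lideal lgrp (code s)) ` {s \<in> sections. leq 0 s}"
  by (simp add: Idc_def pos_cone_lgrp image_image)

lemma lattice_iso_ideal_supp: "lattice_iso (Idc lgrp) type_order ideal_supp"
proof -
  let ?C = "principal_lideal lgrp ` pos_cone lgrp"
  have C: "?C = carrier (Idc lgrp)" by (simp add: Idc_def)
  have le: "x \<subseteq> y \<longleftrightarrow> ideal_supp x \<le> ideal_supp y" if xy: "x \<in> ?C" "y \<in> ?C" for x y
  proof -
    obtain s t where "s \<in> sections" "leq 0 s" "x = principal_lideal lgrp (code s)"
      "t \<in> sections" "leq 0 t" "y = principal_lideal lgrp (code t)"
      using xy unfolding C carrier_Idc by auto
    then show ?thesis by (simp add: ideal_supp_principal principal_subset_iff_supp)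
  qed
  have "bij_betw ideal_supp ?C UNIV"
    unfolding bij_betw_def
  proof
    show "inj_on ideal_supp ?C"
      using le by (intro inj_onI) (metis order.antisym order.refl)
    show "ideal_supp ` ?C = UNIV"
    proof (rule UNIV_eq_I[symmetric])
      fix z
      obtain s where "s \<in> sections" "leq 0 s" "supp s = z" using supp_surj by blast
      then show "z \<in> ideal_supp ` ?C"
        unfolding C carrier_Idc by (intro image_eqI[of _ _ "principal_lideal lgrp (code s)"])
          (auto simp: ideal_supp_principal)
    qed
  qed
  then show ?thesis unfolding Idc_def using le by (rule lattice_iso_type_orderI)
qed

end

section \<open>The homomorphism of groups induced by a lattice homomorphism\<close>

locale valuation_morphism = K: closed_valuation \<nu>\<^sub>K + L: closed_valuation \<nu>\<^sub>L
  for \<nu>\<^sub>K :: "rat poly \<Rightarrow> 'k::{distrib_lattice, bounded_lattice_bot}"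
    and \<nu>\<^sub>L :: "rat poly \<Rightarrow> 'l::{distrib_lattice, bounded_lattice_bot}" +
  fixes \<phi> :: "'k \<Rightarrow> 'l" and \<iota> :: "rat poly \<Rightarrow> rat poly"
  assumes hom: "zero_lattice_hom \<phi>"
    and \<iota>_add: "\<iota> (u + v) = \<iota> u + \<iota> v"
    and \<nu>_\<iota>: "\<nu>\<^sub>L (\<iota> v) = \<phi> (\<nu>\<^sub>K v)"
begin

lemma \<iota>_diff: "\<iota> (u - v) = \<iota> u - \<iota> v"
  using \<iota>_add[of "u - v" v] by simp

text \<open>Precomposition with \<open>\<phi>\<close> sends points of the target lattice to points
  of the source. A section is pulled back along it, and \<open>\<iota>\<close> then moves its values
  into the other vector space.\<close>

definition push :: "(('k \<Rightarrow> bool) \<Rightarrow> rat poly) \<Rightarrow> ('l \<Rightarrow> bool) \<Rightarrow> rat poly" where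
  "push s = (\<lambda>P. \<iota> (s (P \<circ> \<phi>)))"

lemma pos_push: "P (\<nu>\<^sub>L (push s P - \<iota> f)) = (P \<circ> \<phi>) (\<nu>\<^sub>K (s (P \<circ> \<phi>) - f))"
  "P (\<nu>\<^sub>L (\<iota> f - push s P)) = (P \<circ> \<phi>) (\<nu>\<^sub>K (f - s (P \<circ> \<phi>)))"
  "P (\<nu>\<^sub>L (push s P - push t P)) = (P \<circ> \<phi>) (\<nu>\<^sub>K (s (P \<circ> \<phi>) - t (P \<circ> \<phi>)))"
  by (simp_all add: push_def \<nu>_\<iota> flip: \<iota>_diff)

lemma push_section:
  assumes "s \<in> K.sections" shows "push s \<in> L.sections"
proof -
  obtain D where D: "K.presents D s" using assms by (auto simp: K.sections_def)
  let ?h = "\<lambda>(f, w). (\<iota> f, \<phi> w)"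
  have "L.presents (?h ` D) (push s)"
  proof (rule L.presentsI)
    show "finite (?h ` D)" using D K.presents_finite by blast
    fix P :: "'l \<Rightarrow> bool" assume P: "point P"
    obtain f w where f: "(f, w) \<in> D" "\<not> (P \<circ> \<phi>) w"
      using K.presents_cover[OF D point_comp[OF hom P]] by blast
    have "?h (f, w) \<in> ?h ` D" using f by (intro imageI) blast
    then show "\<exists>f w. (f, w) \<in> ?h ` D \<and> \<not> P w"
      using f by (intro exI[of _ "\<iota> f"] exI[of _ "\<phi> w"]) simp
  next
    fix P h v assume P: "point P" and "(h, v) \<in> ?h ` D" and v: "\<not> P v"
    then obtain f w where f: "(f, w) \<in> D" "h = \<iota> f" "\<not> (P \<circ> \<phi>) w" by auto
    then show "\<not> P (\<nu>\<^sub>L (push s P - h)) \<and> \<not> P (\<nu>\<^sub>L (h - push s P))"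
      using K.presents_at[OF D point_comp[OF hom P] f(1,3)] by (simp only: pos_push simp_thms)
  qed
  then show ?thesis by (auto simp: L.sections_def)
qed

lemma push_mono: "K.leq s t \<Longrightarrow> L.leq (push s) (push t)"
  unfolding K.leq_def L.leq_def pos_push using point_comp[OF hom] by blast

lemma push_add: "push (s + t) = push s + push t"
  by (simp add: push_def fun_eq_iff \<iota>_add)

lemma push_uminus: "push (- s) = - push s"
  using \<iota>_diff[of 0] \<iota>_diff[of 0 0] by (simp add: push_def fun_eq_iff)

lemma push_zero: "push 0 = 0"
  using \<iota>_diff[of 0 0] by (simp add: push_def fun_eq_iff)

lemma push_jn: "push (K.jn s t) = L.jn (push s) (push t)"
  unfolding L.jn_def pos_push by (auto simp: push_def K.jn_def fun_eq_iff)

lemma supp_push: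
  assumes "s \<in> K.sections" shows "L.supp (push s) = \<phi> (K.supp s)"
proof (rule eq_pointsI)
  fix P :: "'l \<Rightarrow> bool" assume P: "point P"
  show "P (L.supp (push s)) = P (\<phi> (K.supp s))"
    using L.supp[OF push_section[OF assms] P] K.supp[OF assms point_comp[OF hom P]]
    by (simp add: push_def \<nu>_\<iota>)
qed

definition lift :: "nat \<Rightarrow> nat" where
  "lift m = L.code (push (K.rep m))"

lemma lift_code:
  assumes "s \<in> K.sections" shows "lift (K.code s) = L.code (push s)"
proof -
  have "K.rep (K.code s) \<in> K.sections" using assms K.rep by blast
  then show ?thesis
    unfolding lift_def using assms K.rep_code[OF assms]
    by (simp add: L.code_eq_iff push_section push_mono)
qed

lemma lhom_lift: "lhom K.lgrp L.lgrp lift"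
proof -
  have "lift \<in> hom K.lgrp L.lgrp"
    by (auto simp: hom_def K.carrier_lgrp L.carrier_lgrp lift_code push_section K.code_mult L.code_mult
        push_add)
  moreover have "lift (m \<squnion>\<^bsub>lorder K.lgrp\<^esub> n) = lift m \<squnion>\<^bsub>lorder L.lgrp\<^esub> lift n"
    if "m \<in> carrier K.lgrp" "n \<in> carrier K.lgrp" for m n
    using that by (auto simp: K.carrier_lgrp lift_code push_section K.code_join L.code_join push_jn)
  moreover have "lift (m \<sqinter>\<^bsub>lorder K.lgrp\<^esub> n) = lift m \<sqinter>\<^bsub>lorder L.lgrp\<^esub> lift n"
    if "m \<in> carrier K.lgrp" "n \<in> carrier K.lgrp" for m n
    using that by (auto simp: K.carrier_lgrp lift_code push_section K.code_meet L.code_meet push_jn push_uminus)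
  ultimately show ?thesis
    using K.lattice_lorder L.lattice_lorder
    by (simp add: lhom_def join_pres_def meet_pres_def) (simp add: lorder_def)
qed

lemma represents: "Idc_represents K.lgrp L.lgrp lift K.ideal_supp L.ideal_supp \<phi>"
proof -
  have "\<phi> (K.ideal_supp I) = L.ideal_supp (Idc_map K.lgrp L.lgrp lift I)"
    if I: "I \<in> carrier (Idc K.lgrp)" for I
  proof -
    obtain s where s: "s \<in> K.sections" "K.leq 0 s" and I_def: "I = principal_lideal K.lgrp (K.code s)"
      using I by (auto simp: K.carrier_Idc)
    have "K.code s \<in> pos_cone K.lgrp" using s by (auto simp: K.pos_cone_lgrp)
    then have "Idc_map K.lgrp L.lgrp lift I = principal_lideal L.lgrp (L.code (push s))"
      unfolding I_def using Idc_map_principal[OF K.lg.abelian_lgroup_axioms L.lg.abelian_lgroup_axioms lhom_lift]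
      by (simp add: lift_code s)
    moreover have "L.leq 0 (push s)" using push_mono[OF s(2)] by (simp add: push_zero)
    ultimately show ?thesis
      using s by (simp add: I_def K.ideal_supp_principal L.ideal_supp_principal push_section supp_push)
  qed
  then show ?thesis
    using K.lg.abelian_lgroup_axioms L.lg.abelian_lgroup_axioms lhom_lift
      K.lattice_iso_ideal_supp L.lattice_iso_ideal_supp
    by (simp add: Idc_represents_def)
qed

end

section \<open>Construction of a representation\<close>

text \<open>The vector space for \<open>K\<close> is embedded at the even coordinates of the one for \<open>L\<close>,
  which leaves the odd coordinates for new vectors.\<close>

definition dbl :: "rat poly \<Rightarrow> rat poly" where
  "dbl v = Abs_poly (\<lambda>i. if even i then coeff v (i div 2) else 0)"

definition halve :: "rat poly \<Rightarrow> rat poly" where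
  "halve v = Abs_poly (\<lambda>i. coeff v (2 * i))"

lemma coeff_dbl: "coeff (dbl v) i = (if even i then coeff v (i div 2) else 0)"
proof -
  have "(if even i then coeff v (i div 2) else 0) = 0" if "i > 2 * degree v + 1" for i
    using that by (auto intro: coeff_eq_0)
  then show ?thesis unfolding dbl_def by (subst coeff_Abs_poly) blast+
qed

lemma coeff_halve: "coeff (halve v) i = coeff v (2 * i)"
proof -
  have "coeff v (2 * i) = 0" if "i > degree v" for i
    using that by (intro coeff_eq_0) simp
  then show ?thesis unfolding halve_def by (subst coeff_Abs_poly) blast+
qed

lemma halve_dbl: "halve (dbl v) = v"
  by (rule poly_eqI) (simp add: coeff_halve coeff_dbl)

lemma dbl_add: "dbl (u + v) = dbl u + dbl v"
  by (rule poly_eqI) (simp add: coeff_dbl)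

lemma halve_add: "halve (u + v) = halve u + halve v"
  and halve_uminus: "halve (- u) = - halve u"
  and halve_diff: "halve (u - v) = halve u - halve v"
  and halve_smult: "halve (smult c u) = smult c (halve u)"
  by (rule poly_eqI, simp add: coeff_halve)+

lemma dbl_span: "dbl v \<in> span_upto {i. even i} 0"
  by (simp add: span_upto_def coeff_dbl)

lemma zero_lattice_hom_mono:
  "zero_lattice_hom \<phi> \<Longrightarrow> x \<le> y \<Longrightarrow> \<phi> x \<le> \<phi> y"
  unfolding zero_lattice_hom_def le_iff_sup by metis

text \<open>The \<open>k\<close>-th basis vector receives the \<open>k\<close>-th element of the
  lattice, so the limit is surjective.\<close>

lemma closed_valuation_exists:
  assumes cn: "completely_normal TYPE('k::{distrib_lattice, bounded_lattice_bot})"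
    and count: "countable (UNIV :: 'k::{distrib_lattice, bounded_lattice_bot} set)"
  obtains \<nu> :: "rat poly \<Rightarrow> 'k::{distrib_lattice, bounded_lattice_bot}" where "closed_valuation \<nu>"
proof -
  let ?\<nu> = "\<lambda>_ :: rat poly. bot :: 'k"
  have v: "valuation_on (span_upto {} 0) ?\<nu>"
    unfolding valuation_on_def
  proof (intro allI impI)
    fix P :: "'k \<Rightarrow> bool" assume "point P"
    then show "positive (span_upto {} 0) (P \<circ> ?\<nu>)"
      by unfold_locales (auto simp: subspace_span_upto)
  qed
  have c: "closed_on (span_upto {} 0) ?\<nu>" by (simp add: closed_on_def)
  obtain \<nu> where \<nu>: "valuation_on UNIV \<nu>" "closed_on UNIV \<nu>"
    "\<And>k. \<nu> (monom 1 k) = from_nat_into (UNIV :: 'k set) k"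
    by (rule valuation_extension[OF cn count v c, of "from_nat_into UNIV"]) (use that in blast)
  have "surj \<nu>"
    using \<nu>(3) range_from_nat_into[OF UNIV_not_empty count] by (metis surj_def)
  then show ?thesis using that \<nu> count by (simp add: closed_valuation_def)
qed

text \<open>Closedness of \<open>\<phi>\<close> replaces \<open>x\<close> by some \<open>u\<close>
  in the source lattice, where closedness of the given valuation supplies \<open>n\<close>; applying
  \<open>\<phi>\<close> returns to \<open>x\<close>. The odd coordinates \<open>2 * m + 1\<close>
  then run through the target lattice.\<close>

lemma closed_valuation_push:
  fixes \<phi> :: "'k::{distrib_lattice, bounded_lattice_bot} \<Rightarrow> 'l::{distrib_lattice, bounded_lattice_bot}"
  assumes cn: "completely_normal TYPE('l)" and count: "countable (UNIV :: 'l set)"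
    and hom: "zero_lattice_hom \<phi>" and closed: "closed_hom \<phi>" and K: "closed_valuation \<nu>\<^sub>K"
  obtains \<nu>\<^sub>L where "closed_valuation \<nu>\<^sub>L" "\<And>v. \<nu>\<^sub>L (dbl v) = \<phi> (\<nu>\<^sub>K v)"
proof -
  interpret K: closed_valuation \<nu>\<^sub>K by (rule K)
  let ?S = "{i :: nat. even i}" and ?\<nu> = "\<lambda>v. \<phi> (\<nu>\<^sub>K (halve v))"
  have v: "valuation_on (span_upto ?S 0) ?\<nu>"
    unfolding valuation_on_def
  proof (intro allI impI)
    fix P :: "'l \<Rightarrow> bool" assume P: "point P"
    interpret positive UNIV "(P \<circ> \<phi>) \<circ> \<nu>\<^sub>K"
      using K.positive_point[OF point_comp[OF hom P]] .
    show "positive (span_upto ?S 0) (P \<circ> ?\<nu>)"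
    proof
      show "(P \<circ> ?\<nu>) v \<Longrightarrow> \<not> (P \<circ> ?\<nu>) (- v)" for v
        using pos_asym[of "halve v"] by (simp add: halve_uminus)
      show "(P \<circ> ?\<nu>) (u + v) \<Longrightarrow> (P \<circ> ?\<nu>) u \<or> (P \<circ> ?\<nu>) v" for u v
        using pos_addD[of "halve u" "halve v"] by (simp add: halve_add)
    qed (rule subspace_span_upto)
  qed
  have c: "closed_on (span_upto ?S 0) ?\<nu>"
    unfolding closed_on_def
  proof (intro ballI allI impI)
    fix f g x assume "?\<nu> f \<le> ?\<nu> g \<curlyvee> x"
    then obtain u where u: "\<nu>\<^sub>K (halve f) \<le> \<nu>\<^sub>K (halve g) \<curlyvee> u" "\<phi> u \<le> x"
      using closed unfolding closed_hom_def by blast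
    then obtain n :: nat where n: "\<nu>\<^sub>K (halve f - smult (of_nat n) (halve g)) \<le> u \<curlyvee> \<nu>\<^sub>K (- halve g)"
      using K.closed unfolding closed_on_def by blast
    have "?\<nu> (f - smult (of_nat n) g) \<le> \<phi> (u \<curlyvee> \<nu>\<^sub>K (- halve g))"
      using zero_lattice_hom_mono[OF hom n] by (simp add: halve_diff halve_smult)
    also have "\<dots> = \<phi> u \<curlyvee> ?\<nu> (- g)"
      using hom by (simp add: zero_lattice_hom_def halve_uminus)
    also have "\<dots> \<le> x \<curlyvee> ?\<nu> (- g)" using u(2) by (intro sup_mono order_refl)
    finally show "\<exists>n::nat. ?\<nu> (f - smult (of_nat n) g) \<le> x \<curlyvee> ?\<nu> (- g)" by blast
  qed
  obtain \<nu> where \<nu>: "valuation_on UNIV \<nu>" "closed_on UNIV \<nu>"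
    "\<And>v. v \<in> span_upto ?S 0 \<Longrightarrow> \<nu> v = ?\<nu> v"
    "\<And>k. k \<notin> ?S \<Longrightarrow> \<nu> (monom 1 k) = from_nat_into (UNIV :: 'l set) (k div 2)"
    by (rule valuation_extension[OF cn count v c, of "\<lambda>k. from_nat_into UNIV (k div 2)"]) (use that in blast)
  have "z \<in> range \<nu>" for z
  proof -
    have "z \<in> range (from_nat_into (UNIV :: 'l set))"
      using range_from_nat_into[OF UNIV_not_empty count] by simp
    then obtain m where m: "z = from_nat_into (UNIV :: 'l set) m" by blast
    have "\<nu> (monom 1 (2 * m + 1)) = z" using \<nu>(4)[of "2 * m + 1"] m by simp
    then show ?thesis by blast
  qed
  then have "surj \<nu>" by blast
  then have "closed_valuation \<nu>" using \<nu> count by (simp add: closed_valuation_def)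
  then show ?thesis using that \<nu>(3)[OF dbl_span] by (simp add: halve_dbl)
qed

lemma closed_hom_represented:
  fixes \<phi> :: "'k::{distrib_lattice, bounded_lattice_bot} \<Rightarrow> 'l::{distrib_lattice, bounded_lattice_bot}"
  assumes "countable (UNIV :: 'k set)" and "countable (UNIV :: 'l set)"
    and "completely_normal TYPE('k)" and "completely_normal TYPE('l)"
    and "zero_lattice_hom \<phi>" and "closed_hom \<phi>"
  shows "\<exists>(G :: nat lgroup) (H :: nat lgroup) f \<alpha> \<beta>. Idc_represents G H f \<alpha> \<beta> \<phi>"
proof -
  obtain \<nu>\<^sub>K :: "rat poly \<Rightarrow> 'k" where K: "closed_valuation \<nu>\<^sub>K"
    using closed_valuation_exists assms by blast
  obtain \<nu>\<^sub>L :: "rat poly \<Rightarrow> 'l" where L: "closed_valuation \<nu>\<^sub>L" "\<And>v. \<nu>\<^sub>L (dbl v) = \<phi> (\<nu>\<^sub>K v)"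
    using closed_valuation_push[OF assms(4,2,5,6) K] by blast
  interpret valuation_morphism \<nu>\<^sub>K \<nu>\<^sub>L \<phi> dbl
    using K L assms(5) dbl_add by (intro valuation_morphism.intro valuation_morphism_axioms.intro)
  show ?thesis using represents by blast
qed

section \<open>Represented homomorphisms are closed\<close>

lemma lattice_iso_le_iff:
  assumes iso: "lattice_iso X (type_order :: 'b::{distrib_lattice, bounded_lattice_bot} gorder) \<alpha>"
    and IJ: "I \<in> carrier X" "J \<in> carrier X"
  shows "I \<sqsubseteq>\<^bsub>X\<^esub> J \<longleftrightarrow> \<alpha> I \<le> \<alpha> J"
proof -
  interpret X: lattice X using iso by (simp add: lattice_iso_def join_pres_def)
  interpret Y: lattice "type_order :: 'b gorder" by (rule lattice_type_order)
  have inj: "inj_on \<alpha> (carrier X)" using iso by (simp add: lattice_iso_def bij_betw_def)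
  have "I \<sqsubseteq>\<^bsub>X\<^esub> J \<longleftrightarrow> I = I \<sqinter>\<^bsub>X\<^esub> J" using X.le_iff_join[OF IJ] by auto
  also have "\<dots> \<longleftrightarrow> \<alpha> I = \<alpha> (I \<sqinter>\<^bsub>X\<^esub> J)"
    using inj_on_eq_iff[OF inj IJ(1) X.meet_closed[OF IJ]] by simp
  also have "\<dots> \<longleftrightarrow> \<alpha> I = \<alpha> I \<sqinter>\<^bsub>type_order\<^esub> \<alpha> J"
    using iso IJ by (simp add: lattice_iso_def meet_pres_def)
  also have "\<dots> \<longleftrightarrow> \<alpha> I \<sqsubseteq>\<^bsub>type_order\<^esub> \<alpha> J"
    using Y.le_iff_join[of "\<alpha> I" "\<alpha> J"] by (auto simp: type_order_def)
  finally show ?thesis by (simp add: type_order_def)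
qed

section \<open>Principal ideals of positive elements\<close>

context abelian_lgroup
begin

lemma mult_mono:
  assumes "x \<in> carrier G" "y \<in> carrier G" "u \<in> carrier G" "v \<in> carrier G" "lgle G x y" "lgle G u v"
  shows "lgle G (x \<otimes> u) (y \<otimes> v)"
  using translation_mono[of u v x] translation_mono[of x y v] lg_trans[of "x \<otimes> u" "x \<otimes> v" "y \<otimes> v"] assms
  by (simp add: m_comm)

lemma pos_coneD: "x \<in> pos_cone G \<Longrightarrow> x \<in> carrier G" "x \<in> pos_cone G \<Longrightarrow> lgle G \<one> x"
  by (auto simp: pos_cone_def)

lemma pos_cone_mult:
  assumes "x \<in> pos_cone G" "y \<in> pos_cone G" shows "x \<otimes> y \<in> pos_cone G"
  using mult_mono[of \<one> x \<one> y] assms by (simp add: pos_cone_def)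

lemma labs_pos:
  assumes x: "x \<in> pos_cone G" shows "labs G x = x"
proof -
  have "lgle G (inv x \<otimes> \<one>) (inv x \<otimes> x)"
    using pos_coneD[OF x] by (intro translation_mono) auto
  then have "lgle G (inv x) x"
    using lg_trans[of "inv x" \<one> x] pos_coneD[OF x] by simp
  then show ?thesis
    unfolding labs_def using pos_coneD[OF x] lg_refl
    by (intro ord.join_eqI) (auto simp: lorder_def)
qed

lemma le_mult_pos:
  assumes "x \<in> carrier G" "y \<in> pos_cone G" shows "lgle G x (x \<otimes> y)"
  using translation_mono[of \<one> y x] pos_coneD[OF assms(2)] assms(1) by simp

lemma pow_pos: "x \<in> pos_cone G \<Longrightarrow> x [^] (n::nat) \<in> pos_cone G"
proof (induction n)
  case 0
  then show ?case by (simp add: pos_cone_def lg_refl)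
qed (simp add: pos_cone_mult)

lemma principal_lideal_subset_iff:
  assumes "x \<in> pos_cone G" "y \<in> pos_cone G"
  shows "principal_lideal G x \<subseteq> principal_lideal G y \<longleftrightarrow> (\<exists>n::nat. lgle G x (y [^] n))"
proof
  assume "principal_lideal G x \<subseteq> principal_lideal G y"
  then have "x \<in> principal_lideal G y" using principal_lideal_self pos_coneD assms by blast
  then show "\<exists>n::nat. lgle G x (y [^] n)" using assms by (auto simp: principal_lideal_def labs_pos)
next
  assume "\<exists>n::nat. lgle G x (y [^] n)"
  then show "principal_lideal G x \<subseteq> principal_lideal G y"
    using principal_lideal_mono[of x y] assms pos_coneD by (auto simp: labs_pos)
qed

lemma principal_lideal_in_Idc: "x \<in> pos_cone G \<Longrightarrow> principal_lideal G x \<in> carrier (Idc G)"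
  by (simp add: Idc_def)

lemma iso_principal_le_iff:
  assumes "lattice_iso (Idc G) (type_order :: 'c::{distrib_lattice, bounded_lattice_bot} gorder) \<alpha>"
    and "x \<in> pos_cone G" "y \<in> pos_cone G"
  shows "\<alpha> (principal_lideal G x) \<le> \<alpha> (principal_lideal G y) \<longleftrightarrow> (\<exists>n::nat. lgle G x (y [^] n))"
  using lattice_iso_le_iff[OF assms(1) principal_lideal_in_Idc principal_lideal_in_Idc, OF assms(2,3)]
    principal_lideal_subset_iff[OF assms(2,3)] by (simp add: Idc_def)

lemma iso_principal_surj:
  assumes "lattice_iso (Idc G) (type_order :: 'c::{distrib_lattice, bounded_lattice_bot} gorder) \<alpha>"
  obtains x where "x \<in> pos_cone G" "\<alpha> (principal_lideal G x) = z"
proof -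
  have "z \<in> \<alpha> ` carrier (Idc G)"
    using assms by (simp add: lattice_iso_def bij_betw_def type_order_def)
  then show ?thesis using that by (auto simp: Idc_def)
qed

text \<open>A positive \<open>w\<close> generating the join dominates both elements up to multiples,
  and adding the two estimates bounds their sum by a multiple of \<open>w\<close>.\<close>

lemma iso_principal_mult:
  assumes iso: "lattice_iso (Idc G) (type_order :: 'c::{distrib_lattice, bounded_lattice_bot} gorder) \<alpha>"
    and x: "x \<in> pos_cone G" and y: "y \<in> pos_cone G"
  shows "\<alpha> (principal_lideal G (x \<otimes> y)) = \<alpha> (principal_lideal G x) \<curlyvee> \<alpha> (principal_lideal G y)"
proof (rule order.antisym)
  note car = pos_coneD(1)[OF x] pos_coneD(1)[OF y]
  have "lgle G x ((x \<otimes> y) [^] (1::nat))" "lgle G y ((x \<otimes> y) [^] (1::nat))"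
    using le_mult_pos[OF car(1) y] le_mult_pos[OF car(2) x] car by (simp_all add: m_comm)
  then show "\<alpha> (principal_lideal G x) \<curlyvee> \<alpha> (principal_lideal G y) \<le> \<alpha> (principal_lideal G (x \<otimes> y))"
    using iso_principal_le_iff[OF iso] x y pos_cone_mult by (metis le_sup_iff)
  obtain w where w: "w \<in> pos_cone G"
    "\<alpha> (principal_lideal G w) = \<alpha> (principal_lideal G x) \<curlyvee> \<alpha> (principal_lideal G y)"
    using iso_principal_surj[OF iso] .
  have "\<alpha> (principal_lideal G x) \<le> \<alpha> (principal_lideal G w)" "\<alpha> (principal_lideal G y) \<le> \<alpha> (principal_lideal G w)"
    by (simp_all add: w(2))
  then obtain m n :: nat where "lgle G x (w [^] m)" "lgle G y (w [^] n)"
    using iso_principal_le_iff[OF iso x w(1)] iso_principal_le_iff[OF iso y w(1)] by blast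
  then have "lgle G (x \<otimes> y) (w [^] (m + n))"
    using mult_mono[OF car(1) _ car(2)] pos_coneD(1)[OF w(1)] by (simp add: nat_pow_mult[symmetric])
  then show "\<alpha> (principal_lideal G (x \<otimes> y)) \<le> \<alpha> (principal_lideal G x) \<curlyvee> \<alpha> (principal_lideal G y)"
    using iso_principal_le_iff[OF iso pos_cone_mult[OF x y] w(1)] w(2) by auto
qed

text \<open>Additively, this is the positive part of \<open>g - h\<close>. Together with
  \<open>excess_le\<close> it is the least positive element whose sum with \<open>h\<close> lies
  above \<open>g\<close>.\<close>

lemma excess_pos:
  assumes g: "g \<in> carrier G" and h: "h \<in> carrier G"
  shows "(g \<otimes> inv h) \<squnion>\<^bsub>lorder G\<^esub> \<one> \<in> pos_cone G"
    and "lgle G g (h \<otimes> ((g \<otimes> inv h) \<squnion>\<^bsub>lorder G\<^esub> \<one>))"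
proof -
  let ?e = "g \<otimes> inv h" and ?u = "(g \<otimes> inv h) \<squnion>\<^bsub>lorder G\<^esub> \<one>"
  have u: "?u \<in> carrier G" "lgle G ?e ?u" "lgle G \<one> ?u"
    using ord.join_closed[of ?e \<one>] ord.join_left[of ?e \<one>] ord.join_right[of ?e \<one>] g h
    by (simp_all add: lorder_def)
  then show "?u \<in> pos_cone G" by (simp add: pos_cone_def)
  have "h \<otimes> ?e = g" using g h by (simp add: m_comm[of g] m_assoc[symmetric])
  then show "lgle G g (h \<otimes> ?u)" using translation_mono[of ?e ?u h] u g h by simp
qed

lemma excess_le:
  assumes "g \<in> carrier G" "h \<in> carrier G" "k \<in> pos_cone G" "lgle G g (h \<otimes> k)"
  shows "lgle G ((g \<otimes> inv h) \<squnion>\<^bsub>lorder G\<^esub> \<one>) k"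
proof -
  note k = pos_coneD[OF assms(3)]
  have "lgle G (inv h \<otimes> g) (inv h \<otimes> (h \<otimes> k))"
    using assms k by (intro translation_mono) auto
  then have "lgle G (g \<otimes> inv h) k"
    using assms k by (simp add: m_assoc[symmetric] m_comm)
  then show ?thesis using ord.join_le[of "g \<otimes> inv h" k \<one>] assms k by (simp add: lorder_def)
qed

end

lemma lhom_mono:
  assumes G: "abelian_lgroup G" and H: "abelian_lgroup H" and f: "lhom G H f"
    and "x \<in> carrier G" "y \<in> carrier G" "lgle G x y"
  shows "lgle H (f x) (f y)"
proof -
  have "isotone (lorder G) (lorder H) f"
    using f by (intro join_pres_isotone) (auto simp: lorder_def lhom_def hom_def)
  then show ?thesis using assms by (auto simp: isotone_def lorder_def)
qed

text \<open>With generators \<open>g\<close>, \<open>h\<close>, \<open>k\<close> of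
  \<open>a\<close>, \<open>b\<close>, \<open>x\<close>, the hypothesis becomes, additively,
  \<open>f g \<le> n (f h) + n k\<close>. The witness is the ideal of the positive part of
  \<open>g - n h\<close>: it makes up for what \<open>n h\<close> lacks below \<open>g\<close>, and
  its image is the positive part of \<open>f g - n (f h)\<close>, hence at most
  \<open>n k\<close>.\<close>

lemma represented_closed_hom:
  assumes rep: "Idc_represents G H f \<alpha> \<beta> \<phi>"
  shows "closed_hom \<phi>"
  unfolding closed_hom_def
proof (intro allI impI)
  fix a b x assume le: "\<phi> a \<le> \<phi> b \<curlyvee> x"
  have gr: "abelian_lgroup G" "abelian_lgroup H" and f: "lhom G H f"
    and iso: "lattice_iso (Idc G) type_order \<alpha>" "lattice_iso (Idc H) type_order \<beta>"
    and comm: "\<And>I. I \<in> carrier (Idc G) \<Longrightarrow> \<phi> (\<alpha> I) = \<beta> (Idc_map G H f I)"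
    using rep by (auto simp: Idc_represents_def)
  interpret G: abelian_lgroup G by (rule gr)
  interpret H: abelian_lgroup H by (rule gr)
  interpret group_hom G H f by unfold_locales (use f in \<open>simp add: lhom_def\<close>)
  have comm': "\<phi> (\<alpha> (principal_lideal G y)) = \<beta> (principal_lideal H (f y))" if "y \<in> pos_cone G" for y
    using comm[OF G.principal_lideal_in_Idc[OF that]] Idc_map_principal[OF gr f that] by simp
  have fpos: "f y \<in> pos_cone H" if "y \<in> pos_cone G" for y
    using lhom_mono[OF gr f, of "\<one>\<^bsub>G\<^esub>" y] that by (simp add: pos_cone_def)
  obtain g where g: "g \<in> pos_cone G" "\<alpha> (principal_lideal G g) = a" using G.iso_principal_surj[OF iso(1)] .
  obtain h where h: "h \<in> pos_cone G" "\<alpha> (principal_lideal G h) = b" using G.iso_principal_surj[OF iso(1)] .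
  obtain k where k: "k \<in> pos_cone H" "\<beta> (principal_lideal H k) = x" using H.iso_principal_surj[OF iso(2)] .
  note gc = G.pos_coneD(1)[OF g(1)] and hc = G.pos_coneD(1)[OF h(1)] and kc = H.pos_coneD(1)[OF k(1)]
  have "\<beta> (principal_lideal H (f g)) \<le> \<beta> (principal_lideal H (f h \<otimes>\<^bsub>H\<^esub> k))"
    using le comm'[OF g(1)] comm'[OF h(1)] H.iso_principal_mult[OF iso(2) fpos[OF h(1)] k(1)] g h k by simp
  then obtain n :: nat where "lgle H (f g) ((f h \<otimes>\<^bsub>H\<^esub> k) [^]\<^bsub>H\<^esub> n)"
    using H.iso_principal_le_iff[OF iso(2) fpos[OF g(1)] H.pos_cone_mult[OF fpos[OF h(1)] k(1)]] by blast
  then have n: "lgle H (f g) (f h [^]\<^bsub>H\<^esub> n \<otimes>\<^bsub>H\<^esub> k [^]\<^bsub>H\<^esub> n)"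
    using hc kc by (simp add: H.nat_pow_distrib)
  let ?h = "h [^]\<^bsub>G\<^esub> n"
  define u where "u = (g \<otimes>\<^bsub>G\<^esub> inv\<^bsub>G\<^esub> ?h) \<squnion>\<^bsub>lorder G\<^esub> \<one>\<^bsub>G\<^esub>"
  have u: "u \<in> pos_cone G" "lgle G g (?h \<otimes>\<^bsub>G\<^esub> u)"
    using G.excess_pos[OF gc, of ?h] hc by (simp_all add: u_def)
  note uc = G.pos_coneD(1)[OF u(1)]
  \<comment> \<open>Additively \<open>n h + u \<le> (n + 1) (h + u)\<close>; the exponent
    \<open>Suc n\<close> pays for the extra \<open>u\<close>, also when
    \<open>n = 0\<close>.\<close>
  have "lgle G (?h \<otimes>\<^bsub>G\<^esub> u) (?h \<otimes>\<^bsub>G\<^esub> u \<otimes>\<^bsub>G\<^esub> (h \<otimes>\<^bsub>G\<^esub> u [^]\<^bsub>G\<^esub> n))"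
    using hc uc by (intro G.le_mult_pos G.pos_cone_mult[OF h(1) G.pow_pos[OF u(1)]]) simp
  also have "?h \<otimes>\<^bsub>G\<^esub> u \<otimes>\<^bsub>G\<^esub> (h \<otimes>\<^bsub>G\<^esub> u [^]\<^bsub>G\<^esub> n) = (h \<otimes>\<^bsub>G\<^esub> u) [^]\<^bsub>G\<^esub> Suc n"
    using hc uc by (simp add: G.nat_pow_distrib G.m_ac)
  finally have "lgle G g ((h \<otimes>\<^bsub>G\<^esub> u) [^]\<^bsub>G\<^esub> Suc n)"
    using u(2) G.lg_trans[of g "?h \<otimes>\<^bsub>G\<^esub> u" "(h \<otimes>\<^bsub>G\<^esub> u) [^]\<^bsub>G\<^esub> Suc n"] gc hc uc by blast
  then have "\<alpha> (principal_lideal G g) \<le> \<alpha> (principal_lideal G (h \<otimes>\<^bsub>G\<^esub> u))"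
    using G.iso_principal_le_iff[OF iso(1) g(1) G.pos_cone_mult[OF h(1) u(1)]] by blast
  then have "a \<le> b \<curlyvee> \<alpha> (principal_lideal G u)"
    using G.iso_principal_mult[OF iso(1) h(1) u(1)] g(2) h(2) by simp
  moreover have "\<phi> (\<alpha> (principal_lideal G u)) \<le> x"
  proof -
    have "f u = f (g \<otimes>\<^bsub>G\<^esub> inv\<^bsub>G\<^esub> ?h) \<squnion>\<^bsub>lorder H\<^esub> f \<one>\<^bsub>G\<^esub>"
      using f gc hc by (simp add: u_def lhom_def join_pres_def lorder_def)
    also have "\<dots> = (f g \<otimes>\<^bsub>H\<^esub> inv\<^bsub>H\<^esub> (f h [^]\<^bsub>H\<^esub> n)) \<squnion>\<^bsub>lorder H\<^esub> \<one>\<^bsub>H\<^esub>"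
      using gc hc by (simp add: hom_nat_pow)
    finally have "lgle H (f u) (k [^]\<^bsub>H\<^esub> n)"
      using H.excess_le[OF _ _ H.pow_pos[OF k(1)] n] gc hc by simp
    then show ?thesis
      using comm'[OF u(1)] H.iso_principal_le_iff[OF iso(2) fpos[OF u(1)] k(1)] k(2) by auto
  qed
  ultimately show "\<exists>u. a \<le> b \<curlyvee> u \<and> \<phi> u \<le> x" by blast
qed

theorem mainTheorem4:
  fixes \<phi> :: "'k::{distrib_lattice, bounded_lattice_bot} \<Rightarrow> 'l::{distrib_lattice, bounded_lattice_bot}"
  assumes "countable (UNIV :: 'k set)" and "countable (UNIV :: 'l set)"
    and "completely_normal TYPE('k)" and "completely_normal TYPE('l)"
    and "zero_lattice_hom \<phi>"
  shows "((\<exists>(G :: nat lgroup) (H :: nat lgroup) f \<alpha> \<beta>. Idc_represents G H f \<alpha> \<beta> \<phi>)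
           \<longleftrightarrow> closed_hom \<phi>)
       \<and> ((\<exists>(G :: 'g lgroup) (H :: 'h lgroup) f \<alpha> \<beta>. Idc_represents G H f \<alpha> \<beta> \<phi>)
           \<longrightarrow> closed_hom \<phi>)"
proof (intro conjI iffI impI)
  show "closed_hom \<phi>" if "\<exists>(G :: nat lgroup) (H :: nat lgroup) f \<alpha> \<beta>. Idc_represents G H f \<alpha> \<beta> \<phi>"
    using that represented_closed_hom by blast
  show "closed_hom \<phi>" if "\<exists>(G :: 'g lgroup) (H :: 'h lgroup) f \<alpha> \<beta>. Idc_represents G H f \<alpha> \<beta> \<phi>"
    using that represented_closed_hom by blast
  show "\<exists>(G :: nat lgroup) (H :: nat lgroup) f \<alpha> \<beta>. Idc_represents G H f \<alpha> \<beta> \<phi>" if "closed_hom \<phi>"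
    using closed_hom_represented[OF assms that] .
qed

end
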